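(* Let $\sigma$ be a triangulation of a polygon with $n\ge3$ vertices and $\Gamma_\sigma$ its frozen Jacobian algebra. (1) For all vertices $i,j$ of $Q_\sigma$ there is a path $w_0(i,j)$ from $i$ to $j$ of minimal $\theta$-length such that every path $w$ from $i$ to $j$ satisfies $w=w_0(i,j)C^N$ in $\Gamma_\sigma$ for some integer $N\ge0$. (2) Writing $\ell^\theta_{i,j}=\ell^\theta(w_0(i,j))$, one has $\ell^\theta_{i,j}=\max_{k\in F}\{\ell^\theta_{k,j}-\ell^\theta_{k,i}\}$ for all vertices $i,j$.
   Context: $K$ a field. $P$ is a regular polygon with vertices $P_1,\dots,P_n$ counterclockwise, so each interior angle is $(n-2)\pi/n$; $\sigma$ is a triangulation (maximal set of non-crossing diagonals), all of whose triangle angles are multiples of $\pi/n$. $Q_\sigma$: vertices = edges of $\sigma$ (sides of $P$ and diagonals); internal arrow $a\to b$ when $a,b$ are sides of a common triangle and $a$ precedes $b$ anticlockwise around their common vertex; external arrow $a\to b$ between the two sides of $P$ at each polygon vertex incident to a diagonal, $a$ preceding $b$ anticlockwise. Minimal cycles: cyclic triangles (three internal arrows in a triangle) and big cycles (internal arrows plus one external arrow around a vertex of $P$). $W_\sigma=\sum$cyclic triangles$-\sum$big cycles; $F$ = vertices given by sides of $P$; $\Gamma_\sigma=KQ_\sigma/J$, $J$ generated by the cyclic derivatives $\partial_aW_\sigma$ ($\partial_a(a_1\cdots a_d)=\sum_{a_i=a}a_{i+1}\cdots a_da_1\cdots a_{i-1}$) for arrows $a$ with source or target not in $F$. All minimal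 cycles through a vertex $i$ (as cycles at $i$) are equal in $\Gamma_\sigma$; their class is $C_i$, and $C=\sum_iC_i$. The $\theta$-length of an internal arrow $i\to j$ is $t$ if the angle between edges $i$ and $j$ in their common triangle is $t\pi/n$; the $\theta$-length of an external arrow is $2$; $\ell^\theta$ is extended additively to paths. *)

theory Defs
  imports Main
begin

(* Polygon vertices are 0,...,n-1 in counterclockwise order.
   An edge (side or diagonal) is the 2-element set of its endpoints. *)

type_synonym edge = "nat set"
type_synonym arrow = "edge \<times> edge"
(* a path: its starting vertex of Q_sigma and its list of arrows *)
type_synonym qpath = "edge \<times> arrow list"

definition poly_side :: "nat \<Rightarrow> edge \<Rightarrow> bool" where
  "poly_side n e \<longleftrightarrow> (\<exists>a<n. e = {a, (a + 1) mod n})"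

definition poly_diagonal :: "nat \<Rightarrow> edge \<Rightarrow> bool" where
  "poly_diagonal n e \<longleftrightarrow> (\<exists>a b. a < n \<and> b < n \<and> a \<noteq> b \<and> e = {a, b} \<and> \<not> poly_side n e)"

definition crosses :: "edge \<Rightarrow> edge \<Rightarrow> bool" where
  "crosses e f \<longleftrightarrow>
     (\<exists>a b c d. ((e = {a, b} \<and> f = {c, d}) \<or> (e = {c, d} \<and> f = {a, b})) \<and> a < c \<and> c < b \<and> b < d)"

definition triangulation :: "nat \<Rightarrow> edge set \<Rightarrow> bool" where
  "triangulation n \<sigma> \<longleftrightarrow>
     (\<forall>d\<in>\<sigma>. poly_diagonal n d) \<and>
     (\<forall>d\<in>\<sigma>. \<forall>e\<in>\<sigma>. \<not> crosses d e) \<and>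
     (\<forall>d. poly_diagonal n d \<and> d \<notin> \<sigma> \<longrightarrow> (\<exists>e\<in>\<sigma>. crosses d e))"

definition qverts :: "nat \<Rightarrow> edge set \<Rightarrow> edge set" where
  "qverts n \<sigma> = {e. poly_side n e} \<union> \<sigma>"

definition frozen :: "nat \<Rightarrow> edge set" where
  "frozen n = {e. poly_side n e}"

definition is_triangle :: "nat \<Rightarrow> edge set \<Rightarrow> nat set \<Rightarrow> bool" where
  "is_triangle n \<sigma> T \<longleftrightarrow> T \<subseteq> {..<n} \<and> card T = 3 \<and>
     (\<forall>a\<in>T. \<forall>b\<in>T. a \<noteq> b \<longrightarrow> {a, b} \<in> qverts n \<sigma>)"

(* counterclockwise offset of vertex x as seen from vertex v; around v the edges
   {v,x} appear in anticlockwise order by increasing offset *)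
definition ccw_off :: "nat \<Rightarrow> nat \<Rightarrow> nat \<Rightarrow> nat" where
  "ccw_off n v x = (x + n - v) mod n"

definition internal_arrow :: "nat \<Rightarrow> edge set \<Rightarrow> arrow \<Rightarrow> bool" where
  "internal_arrow n \<sigma> ab \<longleftrightarrow>
     (\<exists>v x y. is_triangle n \<sigma> {v, x, y} \<and> card {v, x, y} = 3 \<and>
        ccw_off n v x < ccw_off n v y \<and> ab = ({v, x}, {v, y}))"

(* external arrow at a polygon vertex v incident to a diagonal, between the two
   sides at v, closing the big cycle around v *)
definition external_arrow :: "nat \<Rightarrow> edge set \<Rightarrow> arrow \<Rightarrow> bool" where
  "external_arrow n \<sigma> ab \<longleftrightarrow>
     (\<exists>v<n. (\<exists>d\<in>\<sigma>. v \<in> d) \<and>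
        ab = ({(v + n - 1) mod n, v}, {v, (v + 1) mod n}))"

definition qarrows :: "nat \<Rightarrow> edge set \<Rightarrow> arrow set" where
  "qarrows n \<sigma> = {ab. internal_arrow n \<sigma> ab \<or> external_arrow n \<sigma> ab}"

definition theta_arrow :: "nat \<Rightarrow> edge set \<Rightarrow> arrow \<Rightarrow> nat" where
  "theta_arrow n \<sigma> ab =
     (if external_arrow n \<sigma> ab then 2
      else (let v = the_elem (fst ab \<inter> snd ab);
                x = the_elem (fst ab - {v});
                y = the_elem (snd ab - {v})
            in ccw_off n v y - ccw_off n v x))"

definition theta_len :: "nat \<Rightarrow> edge set \<Rightarrow> qpath \<Rightarrow> nat" where
  "theta_len n \<sigma> p = sum_list (map (theta_arrow n \<sigma>) (snd p))"

definition pstart :: "qpath \<Rightarrow> edge" where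
  "pstart p = fst p"

definition pend :: "qpath \<Rightarrow> edge" where
  "pend p = (if snd p = [] then fst p else snd (last (snd p)))"

fun chain :: "edge \<Rightarrow> arrow list \<Rightarrow> bool" where
  "chain s [] = True"
| "chain s (a # as) = (fst a = s \<and> chain (snd a) as)"

definition valid_path :: "nat \<Rightarrow> edge set \<Rightarrow> qpath \<Rightarrow> bool" where
  "valid_path n \<sigma> p \<longleftrightarrow> fst p \<in> qverts n \<sigma> \<and> set (snd p) \<subseteq> qarrows n \<sigma> \<and> chain (fst p) (snd p)"

definition path_from_to :: "nat \<Rightarrow> edge set \<Rightarrow> edge \<Rightarrow> edge \<Rightarrow> qpath \<Rightarrow> bool" where
  "path_from_to n \<sigma> i j p \<longleftrightarrow> valid_path n \<sigma> p \<and> pstart p = i \<and> pend p = j"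

definition pcat :: "qpath \<Rightarrow> qpath \<Rightarrow> qpath" where
  "pcat p q = (fst p, snd p @ snd q)"

definition cyc_pow :: "qpath \<Rightarrow> nat \<Rightarrow> qpath" where
  "cyc_pow c N = (fst c, concat (replicate N (snd c)))"

definition cyclic_triangle :: "nat \<Rightarrow> edge set \<Rightarrow> qpath \<Rightarrow> bool" where
  "cyclic_triangle n \<sigma> c \<longleftrightarrow> valid_path n \<sigma> c \<and> pend c = pstart c \<and> length (snd c) = 3 \<and>
     (\<forall>ab\<in>set (snd c). internal_arrow n \<sigma> ab) \<and>
     (\<exists>T. is_triangle n \<sigma> T \<and> (\<forall>ab\<in>set (snd c). fst ab \<subseteq> T \<and> snd ab \<subseteq> T))"

(* big cycle around polygon vertex v (starting at any of its vertices):
   internal arrows around v plus the external arrow at v *)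
definition big_cycle :: "nat \<Rightarrow> edge set \<Rightarrow> qpath \<Rightarrow> bool" where
  "big_cycle n \<sigma> c \<longleftrightarrow> valid_path n \<sigma> c \<and> pend c = pstart c \<and>
     length (filter (external_arrow n \<sigma>) (snd c)) = 1 \<and>
     (\<exists>v<n. \<forall>ab\<in>set (snd c). v \<in> fst ab \<and> v \<in> snd ab)"

definition minimal_cycle_at :: "nat \<Rightarrow> edge set \<Rightarrow> edge \<Rightarrow> qpath \<Rightarrow> bool" where
  "minimal_cycle_at n \<sigma> i c \<longleftrightarrow> (cyclic_triangle n \<sigma> c \<or> big_cycle n \<sigma> c) \<and> pstart c = i"

(* Elements of the path algebra KQ are finitely supported functions qpath => K
   (coefficients of valid paths).  The basis element of a path: *)
definition pelem :: "qpath \<Rightarrow> qpath \<Rightarrow> 'k::field" where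
  "pelem p = (\<lambda>q. if q = p then 1 else 0)"

(* cyclic derivative of W = sum cyclic triangles - sum big cycles w.r.t. arrow a:
   each minimal cycle, rotated to start with a, contributes the rest of the cycle *)
definition cyc_deriv :: "nat \<Rightarrow> edge set \<Rightarrow> arrow \<Rightarrow> qpath \<Rightarrow> 'k::field" where
  "cyc_deriv n \<sigma> a = (\<lambda>p.
      (if (\<exists>c. cyclic_triangle n \<sigma> c \<and> snd c \<noteq> [] \<and> hd (snd c) = a \<and> p = (snd a, tl (snd c))) then 1 else 0)
    - (if (\<exists>c. big_cycle n \<sigma> c \<and> snd c \<noteq> [] \<and> hd (snd c) = a \<and> p = (snd a, tl (snd c))) then 1 else 0))"

definition sandwich :: "nat \<Rightarrow> edge set \<Rightarrow> qpath \<Rightarrow> (qpath \<Rightarrow> 'k::field) \<Rightarrow> qpath \<Rightarrow> qpath \<Rightarrow> 'k" where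
  "sandwich n \<sigma> u x v = (\<lambda>p. sum x {q. valid_path n \<sigma> q \<and> pstart q = pend u \<and> pend q = pstart v \<and>
                                      pcat (pcat u q) v = p})"

inductive_set jac_ideal :: "nat \<Rightarrow> edge set \<Rightarrow> (qpath \<Rightarrow> 'k::field) set" for n \<sigma> where
  zero: "(\<lambda>_. 0) \<in> jac_ideal n \<sigma>"
| add: "x \<in> jac_ideal n \<sigma> \<Longrightarrow> y \<in> jac_ideal n \<sigma> \<Longrightarrow> (\<lambda>p. x p + y p) \<in> jac_ideal n \<sigma>"
| smult: "x \<in> jac_ideal n \<sigma> \<Longrightarrow> (\<lambda>p. c * x p) \<in> jac_ideal n \<sigma>"
| gen: "a \<in> qarrows n \<sigma> \<Longrightarrow> (fst a \<notin> frozen n \<or> snd a \<notin> frozen n) \<Longrightarrow>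
        valid_path n \<sigma> u \<Longrightarrow> valid_path n \<sigma> v \<Longrightarrow>
        sandwich n \<sigma> u (cyc_deriv n \<sigma> a) v \<in> jac_ideal n \<sigma>"

definition jac_eq :: "nat \<Rightarrow> edge set \<Rightarrow> (qpath \<Rightarrow> 'k::field) \<Rightarrow> (qpath \<Rightarrow> 'k) \<Rightarrow> bool" where
  "jac_eq n \<sigma> x y \<longleftrightarrow> (\<lambda>p. x p - y p) \<in> jac_ideal n \<sigma>"

end

theory Submission
  imports Defs
begin

text \<open>
  Lift an edge to a pair of integers \<open>p < q < p + n\<close> modulo the deck transformation
  \<open>\<tau> (p, q) = (q, p + n)\<close>. Every arrow lifts uniquely to a step that increases the pair componentwise,
  and its \<open>\<theta>\<close>-length is the increase of \<open>p + q\<close>; the minimal cycles are the paths from \<open>x\<close> to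
  \<open>\<tau> x\<close>. Non-crossing and maximality imply that there is a path from \<open>x\<close> to \<open>y\<close> as soon as
  \<open>x \<le> y\<close> componentwise, and that two different steps out of \<open>x\<close> below a common \<open>y\<close> can be
  completed below \<open>y\<close> to the two sides of a cyclic derivative. By induction all paths from \<open>x\<close> to
  \<open>y\<close> agree in the Jacobian algebra, so a path is determined by its ends and its \<open>\<theta>\<close>-length,
  which is determined modulo \<open>n\<close> by the ends. The minimal length from \<open>x\<close> to \<open>y\<close> is the height
  difference to the lowest lift of \<open>y\<close> above \<open>x\<close>, which gives the formula with the maximum.
\<close>

text \<open>Length can become height because of inscribed angles: in a regular \<open>n\<close>-gon
  the angle at a vertex between the chords to two other vertices is pi/n times the difference of
  their anticlockwise offsets. The derivatives that occur are differences of two paths, so equality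
  in the Jacobian algebra is handled by a congruence \<open>pcong\<close> on arrow lists and
  transferred to \<open>jac_eq\<close> only at the end. External arrows join two frozen vertices, so
  only derivatives at internal arrows are available, and among these not the one between the two
  sides of an ear. They are just enough: whenever two steps leave a lift, some relation begins with
  them. The danger is that the common end of the relation overshoots \<open>y\<close>. A diagonal
  lies in two triangles and so offers two relations; non-crossing guarantees that one of them stays
  below \<open>y\<close>.\<close>

section \<open>Equality in the Jacobian algebra and concatenation of paths\<close>

lemma jac_eq_refl: "jac_eq n \<sigma> x x"
  unfolding jac_eq_def using jac_ideal.zero by simp

lemma jac_eq_sym: "jac_eq n \<sigma> x y \<Longrightarrow> jac_eq n \<sigma> y x"
  unfolding jac_eq_def by (drule jac_ideal.smult[of _ _ _ "- 1"]) simp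

lemma jac_eq_trans: "jac_eq n \<sigma> x y \<Longrightarrow> jac_eq n \<sigma> y z \<Longrightarrow> jac_eq n \<sigma> x z"
  unfolding jac_eq_def by (drule (1) jac_ideal.add) simp

lemma pend_append: "pend (s, as @ bs) = pend (pend (s, as), bs)"
  by (simp add: pend_def)

lemma chain_append: "chain s (as @ bs) \<longleftrightarrow> chain s as \<and> chain (pend (s, as)) bs"
  by (induction as arbitrary: s) (auto simp: pend_def)

text \<open>On an oriented 3-cycle with distinct vertices each arrow determines the next, so the
  first arrow determines the list. This leaves three rotations when the cyclic triangles are
  classified.\<close>

lemma three_cycle:
  assumes "X \<noteq> Y" "Y \<noteq> Z" "Z \<noteq> X"
    and "a = (X, Y) \<or> a = (Y, Z) \<or> a = (Z, X)" "b = (X, Y) \<or> b = (Y, Z) \<or> b = (Z, X)"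
    and "d = (X, Y) \<or> d = (Y, Z) \<or> d = (Z, X)" "fst b = snd a" "fst d = snd b"
  shows "(fst a, [a, b, d]) = (X, [(X, Y), (Y, Z), (Z, X)]) \<or>
    (fst a, [a, b, d]) = (Z, [(Z, X), (X, Y), (Y, Z)]) \<or> (fst a, [a, b, d]) = (Y, [(Y, Z), (Z, X), (X, Y)])"
  using assms(4-6) by (elim disjE) (insert assms(1-3,7,8), simp_all)

lemma theta_len_append: "theta_len n \<sigma> (s, as @ bs) = theta_len n \<sigma> (s, as) + theta_len n \<sigma> (t, bs)"
  by (simp add: theta_len_def)

lemma sandwich_diff:
  "sandwich n \<sigma> u (\<lambda>p. x p - y p) v = (\<lambda>p. sandwich n \<sigma> u x v p - sandwich n \<sigma> u y v p)"
  by (simp add: sandwich_def sum_subtractf)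

lemma sandwich_pelem:
  assumes "valid_path n \<sigma> (pend u, l)" "pend (pend u, l) = pstart v"
  shows "sandwich n \<sigma> u (pelem (pend u, l)) v = pelem (fst u, snd u @ l @ snd v)"
proof
  fix P :: qpath
  define S where "S = {q. valid_path n \<sigma> q \<and> pstart q = pend u \<and> pend q = pstart v \<and> pcat (pcat u q) v = P}"
  \<comment> \<open>\<open>sum\<close> over an infinite set is 0, so the fibre must be shown finite:
    the middle factor is recovered from \<open>P\<close> by cutting off the lengths of
    \<open>u\<close> and \<open>v\<close>.\<close>
  have "S \<subseteq> {(pend u, take (length (snd P) - length (snd u) - length (snd v)) (drop (length (snd u)) (snd P)))}"
    by (auto simp: S_def pcat_def pstart_def)
  then have "finite S" by (rule finite_subset) simp
  then have "sandwich n \<sigma> u (pelem (pend u, l)) v P = (if (pend u, l) \<in> S then 1 else 0)"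
    unfolding sandwich_def pelem_def S_def by (simp add: sum.delta)
  also have "\<dots> = pelem (fst u, snd u @ l @ snd v) P"
    using assms by (auto simp: S_def pelem_def pcat_def pstart_def)
  finally show "sandwich n \<sigma> u (pelem (pend u, l)) v P = pelem (fst u, snd u @ l @ snd v) P" .
qed

section \<open>The integers as universal cover of the polygon vertices\<close>

locale triangulated_polygon =
  fixes n :: nat and \<sigma> :: "edge set"
  assumes n3: "n \<ge> 3" and tri: "triangulation n \<sigma>"
begin

abbreviation N :: int where "N \<equiv> int n"

text \<open>The covering map onto the residues modulo \<open>n\<close>. On integers the cyclic order
  of the polygon vertices becomes a linear order within each window of length
  \<open>N\<close>.\<close>

definition vertex :: "int \<Rightarrow> nat" where "vertex p = nat (p mod N)"

lemma N3: "N \<ge> 3" using n3 by simp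

lemma vertex_less [simp]: "vertex p < n"
  using N3 by (simp add: vertex_def nat_less_iff)

lemma int_vertex [simp]: "int (vertex p) = p mod N"
  using N3 by (simp add: vertex_def)

lemma vertex_eq_iff: "vertex p = vertex q \<longleftrightarrow> p mod N = q mod N"
  by (metis int_vertex of_nat_eq_iff)

lemma vertex_shift [simp]: "vertex (p + N) = vertex p" "vertex (p - N) = vertex p"
  by (simp_all add: vertex_eq_iff)

lemma vertex_of_nat: "a < n \<Longrightarrow> vertex (int a) = a"
  by (simp add: vertex_def)

lemma vertex_eqE:
  assumes "vertex p = vertex q"
  obtains k where "q = p + k * N"
proof -
  have "N dvd q - p"
    using assms by (metis vertex_eq_iff mod_eq_dvd_iff)
  then obtain k where "q - p = N * k" by (auto elim: dvdE)
  then have "q = p + k * N" by (simp add: algebra_simps)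
  then show ?thesis using that by blast
qed

lemma vertex_inj: "vertex p = vertex q \<Longrightarrow> \<bar>p - q\<bar> < N \<Longrightarrow> p = q"
proof -
  assume "vertex p = vertex q" and *: "\<bar>p - q\<bar> < N"
  then have "N dvd p - q" by (metis vertex_eq_iff mod_eq_dvd_iff)
  then show "p = q" using * dvd_imp_le_int[of "p - q" N] by fastforce
qed

lemma vertex_neq: "p < q \<Longrightarrow> q < p + N \<Longrightarrow> vertex p \<noteq> vertex q"
  using vertex_inj[of p q] by auto

lemma vertex_lift:
  assumes "a < n"
  obtains w where "p \<le> w" "w < p + N" "vertex w = a"
proof
  let ?w = "p + (int a - p) mod N"
  show "p \<le> ?w" "?w < p + N" using N3 by simp_all
  have "?w mod N = int a mod N" by (simp add: mod_simps)
  then have "vertex ?w = vertex (int a)" by (simp only: vertex_eq_iff)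
  then show "vertex ?w = a" using vertex_of_nat[OF assms] by simp
qed

lemma vertex_succ: "(vertex p + 1) mod n = vertex (p + 1)"
proof -
  have "int ((vertex p + 1) mod n) = int (vertex (p + 1))"
    by (simp add: zmod_int mod_simps add.commute)
  then show ?thesis by (simp only: of_nat_eq_iff)
qed

lemma vertex_pred: "(vertex p + n - 1) mod n = vertex (p - 1)"
proof -
  have "int (vertex p + n - 1) = p mod N + N - 1"
    using n3 by (subst of_nat_diff) auto
  then have "int ((vertex p + n - 1) mod n) = (p mod N + N - 1) mod N"
    by (simp only: zmod_int)
  also have "\<dots> = (p mod N - 1 + N) mod N" by (simp add: algebra_simps)
  also have "\<dots> = int (vertex (p - 1))" by (simp add: mod_simps)
  finally show ?thesis by (simp only: of_nat_eq_iff)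
qed

text \<open>Links the offsets that define arrows and their lengths to differences of integer
  lifts.\<close>

lemma ccw_off_vertex:
  assumes "p \<le> q" "q < p + N"
  shows "int (ccw_off n (vertex p) (vertex q)) = q - p"
proof -
  have "vertex p \<le> vertex q + n" using vertex_less[of p] by linarith
  then have "int (vertex q + n - vertex p) = q mod N + N - p mod N"
    by (subst of_nat_diff) auto
  then have "int (ccw_off n (vertex p) (vertex q)) = (q mod N + N - p mod N) mod N"
    by (simp only: ccw_off_def zmod_int)
  also have "\<dots> = (q mod N - p mod N + N) mod N" by (simp add: algebra_simps)
  also have "\<dots> = (q - p) mod N" by (simp add: mod_simps)
  also have "\<dots> = q - p" using assms by simp
  finally show ?thesis .
qed

lemma poly_side_iff: "poly_side n e \<longleftrightarrow> (\<exists>p. e = {vertex p, vertex (p + 1)})"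
  unfolding poly_side_def by (metis vertex_less vertex_of_nat vertex_succ)

text \<open>The gap is 1 or \<open>N - 1\<close> according to which end of the side is taken as the
  first entry of the lift.\<close>

lemma poly_side_vertex:
  assumes "p < q" "q < p + N"
  shows "poly_side n {vertex p, vertex q} \<longleftrightarrow> q = p + 1 \<or> q = p + N - 1"
proof
  assume "poly_side n {vertex p, vertex q}"
  then obtain a where "{vertex p, vertex q} = {vertex a, vertex (a + 1)}"
    by (auto simp: poly_side_iff)
  then consider "vertex p = vertex a" "vertex q = vertex (a + 1)" | "vertex q = vertex a" "vertex p = vertex (a + 1)"
    by (auto simp: doubleton_eq_iff)
  then show "q = p + 1 \<or> q = p + N - 1"
  proof cases
    case 1
    then have "vertex q = vertex (p + 1)" by (metis vertex_succ)
    then show ?thesis using assms N3 vertex_inj[of q "p + 1"] by auto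
  next
    case 2
    then have "vertex (p + N) = vertex (q + 1)" by (metis vertex_succ vertex_shift(1))
    then show ?thesis using assms N3 vertex_inj[of "p + N" "q + 1"] by auto
  qed
next
  assume "q = p + 1 \<or> q = p + N - 1"
  then show "poly_side n {vertex p, vertex q}"
  proof
    assume "q = p + N - 1"
    moreover have "vertex (p + N - 1) = vertex (p - 1)"
      using vertex_shift(1)[of "p - 1"] by (simp add: algebra_simps)
    ultimately have "{vertex p, vertex q} = {vertex (p - 1), vertex (p - 1 + 1)}" by auto
    then show ?thesis by (auto simp only: poly_side_iff)
  qed (auto simp: poly_side_iff)
qed

text \<open>Lifts of edges to the universal cover of the boundary circle; \<open>(p, q)\<close> and \<open>(q, p + n)\<close>
  lift the same edge.\<close>

definition chord :: "int \<Rightarrow> int \<Rightarrow> bool" where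
  "chord p q \<longleftrightarrow> p < q \<and> q < p + N \<and> {vertex p, vertex q} \<in> qverts n \<sigma>"

lemma chord_less: "chord p q \<Longrightarrow> p < q" "chord p q \<Longrightarrow> q < p + N"
  by (auto simp: chord_def)

lemma chord_tau: "chord q (p + N) \<longleftrightarrow> chord p q"
  by (auto simp: chord_def insert_commute)

lemma chord_tau': "chord (q - N) p \<longleftrightarrow> chord p q"
  using chord_tau[of p "q - N"] chord_tau[of q p] chord_tau[of "q-N" p] by simp

lemma chord_side: "chord p (p + 1)"
  using N3 by (auto simp: chord_def qverts_def poly_side_iff)

lemma diagonal_elim:
  assumes "d \<in> \<sigma>" obtains a b where "a < n" "b < n" "a \<noteq> b" "d = {a, b}" "\<not> poly_side n d"
  using assms tri by (auto simp: triangulation_def poly_diagonal_def)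

lemma edge_lift:
  assumes "e \<in> qverts n \<sigma>" "a \<in> e" "vertex p = a"
  obtains q where "chord p q" "e = {vertex p, vertex q}"
proof -
  obtain b where b: "b < n" "a \<noteq> b" "e = {a, b}"
  proof (cases "e \<in> \<sigma>")
    case True
    then show ?thesis using that assms(2) by (elim diagonal_elim) (auto simp: insert_commute)
  next
    case False
    then obtain c where "e = {vertex c, vertex (c + 1)}"
      using assms(1) by (auto simp: qverts_def poly_side_iff)
    moreover have "vertex c \<noteq> vertex (c + 1)" using N3 by (intro vertex_neq) auto
    ultimately show ?thesis
      using that[of "vertex c"] that[of "vertex (c + 1)"] assms(2) by (auto simp: insert_commute)
  qed
  obtain q where q: "p \<le> q" "q < p + N" "vertex q = b" using vertex_lift[OF b(1)] by blast
  then have "p \<noteq> q" using b assms(3) by auto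
  then show ?thesis using that[of q] q b assms by (auto simp: chord_def)
qed

section \<open>Crossing and maximality in the cover\<close>

text \<open>\<open>crosses\<close> compares labels in 0, ..., n-1 and so refers to the place where
  the labelling starts, whereas interleaving in the cover does not. The symmetric disjunction in
  \<open>crosses\<close> absorbs the possible positions of the wrap-around.\<close>

lemma crosses_vertex:
  assumes "p < c" "c < q" "q < d" "d < p + N"
  shows "crosses {vertex p, vertex q} {vertex c, vertex d}"
proof -
  \<comment> \<open>Translate p into [0, n); the cases below say which of the points then wrap around.\<close>
  define t where "t = N * (p div N)"
  have vt: "vertex (x + t) = vertex x" for x by (simp add: t_def vertex_eq_iff)
  define P C Q D where "P = p - t" and "C = c - t" and "Q = q - t" and "D = d - t"
  have P0: "0 \<le> P" "P < N" using N3 by (auto simp: P_def t_def minus_mult_div_eq_mod)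
  have o: "P < C" "C < Q" "Q < D" "D < P + N"
    using assms by (auto simp: P_def C_def Q_def D_def)
  have v: "vertex p = vertex P" "vertex c = vertex C" "vertex q = vertex Q" "vertex d = vertex D"
    using vt[of P] vt[of C] vt[of Q] vt[of D] by (simp_all add: P_def C_def Q_def D_def)
  have s: "vertex x = nat x" if "0 \<le> x" "x < N" for x using that by (simp add: vertex_def)
  have b: "vertex x = nat (x - N)" if "N \<le> x" "x < 2 * N" for x
    using s[of "x - N"] that by simp
  consider "D < N" | "Q < N" "N \<le> D" | "C < N" "N \<le> Q" | "N \<le> C" by linarith
  then show ?thesis
  proof cases
    case 1
    then have "vertex P < vertex C \<and> vertex C < vertex Q \<and> vertex Q < vertex D"
      using o P0 by (simp add: s)
    then show ?thesis unfolding crosses_def v by blast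
  next
    case 2
    then have "vertex D < vertex P \<and> vertex P < vertex C \<and> vertex C < vertex Q"
      using o P0 by (simp add: s b)
    then show ?thesis unfolding crosses_def v
      by (intro exI[of _ "vertex D"] exI[of _ "vertex C"] exI[of _ "vertex P"] exI[of _ "vertex Q"]) (auto simp: insert_commute)
  next
    case 3
    then have "vertex Q < vertex D \<and> vertex D < vertex P \<and> vertex P < vertex C"
      using o P0 by (simp add: s b)
    then show ?thesis unfolding crosses_def v
      by (intro exI[of _ "vertex Q"] exI[of _ "vertex P"] exI[of _ "vertex D"] exI[of _ "vertex C"]) (auto simp: insert_commute)
  next
    case 4
    then have "vertex C < vertex Q \<and> vertex Q < vertex D \<and> vertex D < vertex P"
      using o P0 by (simp add: s b)
    then show ?thesis unfolding crosses_def v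
      by (intro exI[of _ "vertex C"] exI[of _ "vertex D"] exI[of _ "vertex Q"] exI[of _ "vertex P"]) (auto simp: insert_commute)
  qed
qed

text \<open>Crossing means separation: among lifts in the window starting at \<open>p\<close>,
  exactly one end of the second edge lies before \<open>q\<close>; that end is called
  \<open>c\<close>. The eight label orders allowed by \<open>crosses\<close> all lead to
  this.\<close>

lemma crossesE:
  assumes "crosses {vertex p, vertex q} {a, b}" "a < n" "b < n" "p < q" "q < p + N"
  obtains c d where "p < c" "c < q" "q < d" "d < p + N" "{a, b} = {vertex c, vertex d}"
proof -
  obtain c where c: "p \<le> c" "c < p + N" "vertex c = a" using vertex_lift[OF assms(2)] by blast
  obtain d where d: "p \<le> d" "d < p + N" "vertex d = b" using vertex_lift[OF assms(3)] by blast
  have ne: "c \<noteq> p" "c \<noteq> q" "d \<noteq> p" "d \<noteq> q"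
    using assms(1) c d by (auto simp: crosses_def doubleton_eq_iff)
  define t where "t = N * (p div N)"
  have vt: "vertex (x + t) = vertex x" for x by (simp add: t_def vertex_eq_iff)
  define P C Q D where "P = p - t" and "C = c - t" and "Q = q - t" and "D = d - t"
  have P0: "0 \<le> P" "P < N" using N3 by (auto simp: P_def t_def minus_mult_div_eq_mod)
  have v: "vertex p = vertex P" "vertex c = vertex C" "vertex q = vertex Q" "vertex d = vertex D"
    using vt[of P] vt[of C] vt[of Q] vt[of D] by (simp_all add: P_def C_def Q_def D_def)
  have s: "int (vertex x) = (if x < N then x else x - N)" if "P \<le> x" "x < P + N" for x
  proof (cases "x < N")
    case False
    then have "(x - N) mod N = x - N" using that P0 by (intro mod_pos_pos_trivial) auto
    then show ?thesis using False by simp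
  qed (use that P0 in \<open>simp add: vertex_def\<close>)
  have ss: "int (vertex P) = P" using P0 by (simp add: vertex_def)
  have r: "P < Q" "Q < P + N" "P < C" "C < P + N" "P < D" "D < P + N"
    using c d ne assms by (auto simp: P_def C_def Q_def D_def)
  have sQ: "int (vertex Q) = (if Q < N then Q else Q - N)"
    and sC: "int (vertex C) = (if C < N then C else C - N)"
    and sD: "int (vertex D) = (if D < N then D else D - N)"
    using r s by auto
  have "crosses {vertex P, vertex Q} {vertex C, vertex D}" using assms(1) c d v by simp
  then obtain w x y z where w: "w < x" "x < y" "y < z" and
    "({vertex P, vertex Q} = {w, y} \<and> {vertex C, vertex D} = {x, z}) \<or> ({vertex P, vertex Q} = {x, z} \<and> {vertex C, vertex D} = {w, y})"
    unfolding crosses_def by blast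
  then have "vertex P < vertex C \<and> vertex C < vertex Q \<and> vertex Q < vertex D \<or> vertex P < vertex D \<and> vertex D < vertex Q \<and> vertex Q < vertex C \<or>
    vertex Q < vertex C \<and> vertex C < vertex P \<and> vertex P < vertex D \<or> vertex Q < vertex D \<and> vertex D < vertex P \<and> vertex P < vertex C \<or>
    vertex C < vertex P \<and> vertex P < vertex D \<and> vertex D < vertex Q \<or> vertex D < vertex P \<and> vertex P < vertex C \<and> vertex C < vertex Q \<or>
    vertex C < vertex Q \<and> vertex Q < vertex D \<and> vertex D < vertex P \<or> vertex D < vertex Q \<and> vertex Q < vertex C \<and> vertex C < vertex P"
    unfolding doubleton_eq_iff by (elim disjE conjE) (simp_all only: simp_thms)
  then have "(C < Q) \<noteq> (D < Q)"
    unfolding of_nat_less_iff[where 'a = int, symmetric] ss sQ sC sD using r P0 by (smt (verit))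
  then consider "C < Q" "Q < D" | "D < Q" "Q < C"
    using ne by (auto simp: C_def D_def Q_def)
  then show ?thesis
  proof cases
    case 1
    then show ?thesis using that[of c d] r c d by (auto simp: P_def C_def Q_def D_def)
  next
    case 2
    then show ?thesis using that[of d c] r c d by (auto simp: P_def C_def Q_def D_def)
  qed
qed

lemma chord_diagonal:
  assumes "chord p q" "p + 1 < q" "q + 1 < p + N"
  shows "{vertex p, vertex q} \<in> \<sigma>"
  using assms poly_side_vertex[of p q] by (auto simp: chord_def qverts_def)

text \<open>The definition of a triangulation forbids crossings of diagonals only. Strict
  interleaving forces both gaps away from 1 and \<open>N - 1\<close>, so both chords are diagonals
  and the prohibition covers sides as well.\<close>

lemma chord_noncrossing:
  assumes "chord p q" "chord c d" "p < c" "c < q" "q < d" "d < p + N"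
  shows False
proof -
  have "{vertex p, vertex q} \<in> \<sigma>" "{vertex c, vertex d} \<in> \<sigma>"
    using assms by (auto intro!: chord_diagonal)
  then show False using crosses_vertex[OF assms(3-6)] tri by (auto simp: triangulation_def)
qed

lemma chord_maximal:
  assumes "\<not> chord p q" "p < q" "q < p + N"
  obtains c d where "chord c d" "p < c" "c < q" "q < d" "d < p + N"
proof -
  have "poly_diagonal n {vertex p, vertex q}"
    unfolding poly_diagonal_def
    using assms vertex_neq[of p q] by (intro exI[of _ "vertex p"] exI[of _ "vertex q"]) (auto simp: chord_def qverts_def)
  moreover have "{vertex p, vertex q} \<notin> \<sigma>" using assms by (auto simp: chord_def qverts_def)
  ultimately obtain e where e: "e \<in> \<sigma>" "crosses {vertex p, vertex q} e"
    using tri by (auto simp: triangulation_def)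
  obtain a b where ab: "a < n" "b < n" "e = {a, b}" using e diagonal_elim by metis
  obtain c d where cd: "p < c" "c < q" "q < d" "d < p + N" "{a, b} = {vertex c, vertex d}"
    using crossesE[of p q a b] e ab assms by metis
  then have "chord c d" using e ab by (auto simp: chord_def qverts_def)
  then show ?thesis using that cd by blast
qed

section \<open>Triangles in the cover\<close>

definition ltriangle :: "int \<Rightarrow> int \<Rightarrow> int \<Rightarrow> bool" where
  "ltriangle a b c \<longleftrightarrow> chord a b \<and> chord b c \<and> chord a c"

lemma ltriangle_less: "ltriangle a b c \<Longrightarrow> a < b \<and> b < c \<and> c < a + N"
  by (auto simp: ltriangle_def chord_def)

lemma ltriangle_rot: "ltriangle b c (a + N) \<longleftrightarrow> ltriangle a b c"
  by (auto simp: ltriangle_def chord_tau)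

lemma ltriangle_rot': "ltriangle (c - N) a b \<longleftrightarrow> ltriangle a b c"
  by (auto simp: ltriangle_def chord_tau')

text \<open>The third vertex is the farthest \<open>r\<close> before \<open>q\<close> that is joined
  to \<open>p\<close>. A chord blocking \<open>(r, q)\<close> would cross \<open>(p, q)\<close>, or
  end at \<open>p + N\<close> and so join \<open>p\<close> to a farther vertex, or cross
  \<open>(p, r)\<close>.\<close>

lemma ltriangle_exists:
  assumes "chord p q" "p + 1 < q"
  obtains r where "ltriangle p r q"
proof -
  define R where "R = {r. p < r \<and> r < q \<and> chord p r}"
  have "finite R" by (rule finite_subset[of _ "{p..q}"]) (auto simp: R_def)
  moreover have "p + 1 \<in> R" using assms chord_side by (simp add: R_def)
  ultimately have "Max R \<in> R" and max: "\<And>u. u \<in> R \<Longrightarrow> u \<le> Max R"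
    by (auto intro!: Max_in)
  define r where "r = Max R"
  have r: "p < r" "r < q" "chord p r" using \<open>Max R \<in> R\<close> by (auto simp: R_def r_def)
  have qN: "q < p + N" using assms chord_less by blast
  have "chord r q"
  proof (rule ccontr)
    assume "\<not> chord r q"
    then obtain u v where uv: "chord u v" "r < u" "u < q" "q < v" "v < r + N"
      using chord_maximal[of r q] r qN by auto
    consider "v < p + N" | "v = p + N" | "v > p + N" by linarith
    then show False
    proof cases
      case 1
      then show False using chord_noncrossing[OF assms(1) uv(1)] uv r by simp
    next
      case 2
      then have "u \<in> R" using uv r by (auto simp: R_def chord_tau)
      then show False using max[of u] uv by (simp add: r_def)
    next
      case 3
      have "chord (v - N) u" using uv chord_tau' by blast
      then show False using chord_noncrossing[OF r(3), of "v - N" u] uv 3 r qN by auto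
    qed
  qed
  then show ?thesis using that[of r] r assms by (simp add: ltriangle_def)
qed

text \<open>For third vertices \<open>u < v\<close> the chords \<open>(p, u)\<close> and
  \<open>(q, v)\<close> would cross.\<close>

lemma ltriangle_unique:
  assumes "ltriangle p q r" "ltriangle p q s" shows "r = s"
proof -
  have "\<not> u < v" if "ltriangle p q u" "ltriangle p q v" for u v
    using that chord_noncrossing[of p u q v] ltriangle_less[OF that(1)] ltriangle_less[OF that(2)] by (auto simp: ltriangle_def)
  then show ?thesis using assms by (meson linorder_neqE)
qed

lemma ltriangle_unique':
  assumes "ltriangle p r q" "ltriangle p s q" shows "r = s"
  using assms ltriangle_unique[of "q - N" p r s] by (simp add: ltriangle_rot')

lemma vertex_shift_mult [simp]: "vertex (p + k * N) = vertex p"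
  by (simp add: vertex_eq_iff)

lemma vertex_add_cong: "vertex p = vertex q \<Longrightarrow> vertex (p + r) = vertex (q + r)"
  by (simp add: vertex_eq_iff) (metis mod_add_cong)

lemma chord_shift: "chord (p + k * N) (q + k * N) \<longleftrightarrow> chord p q"
  by (simp add: chord_def)

lemma ltriangle_shift: "ltriangle (p + k * N) (q + k * N) (r + k * N) \<longleftrightarrow> ltriangle p q r"
  by (simp add: ltriangle_def chord_shift)

section \<open>Lifted edges, heights and the deck transformation\<close>

definition edge_of :: "int \<times> int \<Rightarrow> edge" where "edge_of x = {vertex (fst x), vertex (snd x)}"

definition lifted :: "int \<times> int \<Rightarrow> bool" where "lifted x \<longleftrightarrow> chord (fst x) (snd x)"

definition height :: "int \<times> int \<Rightarrow> int" where "height x = fst x + snd x"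

definition \<tau> :: "int \<times> int \<Rightarrow> int \<times> int" where "\<tau> x = (snd x, fst x + N)"

text \<open>The condition for an external arrow at \<open>v\<close>; without it there is no big
  cycle around \<open>v\<close> either.\<close>

definition has_diagonal :: "int \<Rightarrow> bool" where "has_diagonal v \<longleftrightarrow> (\<exists>d\<in>\<sigma>. vertex v \<in> d)"

lemma edge_of_pair: "edge_of (p, q) = {vertex p, vertex q}"
  by (simp add: edge_of_def)

lemma lifted_pair [simp]: "lifted (p, q) = chord p q"
  by (simp add: lifted_def)

lemma height_pair [simp]: "height (p, q) = p + q"
  by (simp add: height_def)

lemma \<tau>_pair [simp]: "\<tau> (p, q) = (q, p + N)"
  by (simp add: \<tau>_def)

lemma edge_of_\<tau> [simp]: "edge_of (\<tau> x) = edge_of x"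
  by (auto simp: edge_of_def \<tau>_def)

lemma lifted_\<tau> [simp]: "lifted (\<tau> x) = lifted x"
  by (simp add: lifted_def \<tau>_def chord_tau)

lemma height_\<tau>: "height (\<tau> x) = height x + N"
  by (simp add: height_def \<tau>_def)

lemma edge_of_qverts: "lifted x \<Longrightarrow> edge_of x \<in> qverts n \<sigma>"
  by (simp add: lifted_def chord_def edge_of_def)

lemma has_diagonal_iff: "has_diagonal v \<longleftrightarrow> (\<exists>w. chord v w \<and> v + 1 < w \<and> w < v + N - 1)"
proof
  assume "has_diagonal v"
  then obtain d where d: "d \<in> \<sigma>" "vertex v \<in> d" by (auto simp: has_diagonal_def)
  then obtain w where w: "chord v w" "d = {vertex v, vertex w}"
    using edge_lift[of d "vertex v" v] by (auto simp: qverts_def)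
  have "\<not> poly_side n d" using d diagonal_elim by metis
  then have "w \<noteq> v + 1" "w \<noteq> v + N - 1"
    using w poly_side_vertex[of v w] chord_less[OF w(1)] by auto
  then show "\<exists>w. chord v w \<and> v + 1 < w \<and> w < v + N - 1"
    using w chord_less[OF w(1)] by (intro exI[of _ w]) auto
next
  assume "\<exists>w. chord v w \<and> v + 1 < w \<and> w < v + N - 1"
  then obtain w where "chord v w" "v + 1 < w" "w < v + N - 1" by blast
  then have "{vertex v, vertex w} \<in> \<sigma>" by (intro chord_diagonal) auto
  then show "has_diagonal v" unfolding has_diagonal_def by blast
qed

lemma has_diagonal_cong: "vertex v = vertex w \<Longrightarrow> has_diagonal v = has_diagonal w"
  by (simp add: has_diagonal_def)

section \<open>Arrows of the quiver in terms of the cover\<close>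

lemma external_arrow_iff:
  "external_arrow n \<sigma> a \<longleftrightarrow> (\<exists>v. has_diagonal v \<and> a = (edge_of (v - 1, v), edge_of (v, v + 1)))"
proof
  assume "external_arrow n \<sigma> a"
  then obtain v where v: "v < n" "\<exists>d\<in>\<sigma>. v \<in> d" "a = ({(v + n - 1) mod n, v}, {v, (v + 1) mod n})"
    by (auto simp: external_arrow_def)
  have "vertex (int v) = v" using v vertex_of_nat by simp
  then show "\<exists>v. has_diagonal v \<and> a = (edge_of (v - 1, v), edge_of (v, v + 1))"
    using v vertex_pred[of "int v"] vertex_succ[of "int v"]
    by (intro exI[of _ "int v"]) (simp add: has_diagonal_def edge_of_pair)
next
  assume "\<exists>v. has_diagonal v \<and> a = (edge_of (v - 1, v), edge_of (v, v + 1))"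
  then obtain v where v: "has_diagonal v" "a = (edge_of (v - 1, v), edge_of (v, v + 1))" by blast
  then show "external_arrow n \<sigma> a"
    unfolding external_arrow_def
    by (intro exI[of _ "vertex v"]) (use vertex_pred[of v] vertex_succ[of v] in \<open>simp add: has_diagonal_def edge_of_pair\<close>)
qed

lemma ltriangle_is_triangle:
  assumes "ltriangle p q r"
  shows "is_triangle n \<sigma> {vertex p, vertex q, vertex r}" "card {vertex p, vertex q, vertex r} = 3"
proof -
  have "vertex p \<noteq> vertex q" "vertex q \<noteq> vertex r" "vertex p \<noteq> vertex r"
    using assms by (auto simp: ltriangle_def chord_def intro: vertex_neq dest!: vertex_neq)
  then show "card {vertex p, vertex q, vertex r} = 3" by simp
  then show "is_triangle n \<sigma> {vertex p, vertex q, vertex r}"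
    using assms by (auto simp: is_triangle_def ltriangle_def chord_def insert_commute)
qed

lemma chord_of_vertex: "p \<le> q \<Longrightarrow> q < p + N \<Longrightarrow> vertex p \<noteq> vertex q \<Longrightarrow> {vertex p, vertex q} \<in> qverts n \<sigma> \<Longrightarrow> chord p q"
  by (metis chord_def order_le_less)

lemma internal_arrow_iff:
  "internal_arrow n \<sigma> a \<longleftrightarrow> (\<exists>p q r. ltriangle p q r \<and> a = (edge_of (p, q), edge_of (p, r)))"
proof
  assume "internal_arrow n \<sigma> a"
  then obtain v x y where tr: "is_triangle n \<sigma> {v, x, y}" and c3: "card {v, x, y} = 3"
    and off: "ccw_off n v x < ccw_off n v y" and a: "a = ({v, x}, {v, y})"
    unfolding internal_arrow_def by blast
  have less: "v < n" "x < n" "y < n" using tr by (auto simp: is_triangle_def)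
  have ne: "v \<noteq> x" "x \<noteq> y" "v \<noteq> y" using c3 by (auto simp: card_insert_if split: if_splits)
  define p where "p = int v"
  have p: "vertex p = v" using less by (simp add: p_def vertex_of_nat)
  obtain q where q: "p \<le> q" "q < p + N" "vertex q = x" using vertex_lift less by blast
  obtain r where r: "p \<le> r" "r < p + N" "vertex r = y" using vertex_lift less by blast
  have "q < r" using off ccw_off_vertex[OF q(1,2)] ccw_off_vertex[OF r(1,2)] p q r by simp
  then have "ltriangle p q r"
    unfolding ltriangle_def using tr ne p q r by (auto simp: is_triangle_def intro!: chord_of_vertex)
  then show "\<exists>p q r. ltriangle p q r \<and> a = (edge_of (p, q), edge_of (p, r))"
    using a p q r by (intro exI[of _ p] exI[of _ q] exI[of _ r]) (simp add: edge_of_pair)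
next
  assume "\<exists>p q r. ltriangle p q r \<and> a = (edge_of (p, q), edge_of (p, r))"
  then obtain p q r where t: "ltriangle p q r" and a: "a = (edge_of (p, q), edge_of (p, r))" by blast
  have "int (ccw_off n (vertex p) (vertex q)) = q - p" "int (ccw_off n (vertex p) (vertex r)) = r - p"
    using ltriangle_less[OF t] by (auto intro: ccw_off_vertex)
  then have "ccw_off n (vertex p) (vertex q) < ccw_off n (vertex p) (vertex r)"
    using ltriangle_less[OF t] by linarith
  then show "internal_arrow n \<sigma> a"
    unfolding internal_arrow_def using ltriangle_is_triangle[OF t] a by (auto simp: edge_of_pair)
qed

lemma triangle_lift:
  assumes "is_triangle n \<sigma> S"
  obtains p q r where "ltriangle p q r" "S = {vertex p, vertex q, vertex r}"
proof -
  obtain v x y where S: "S = {v, x, y}" "v \<noteq> x" "x \<noteq> y" "v \<noteq> y"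
    using assms by (auto simp: is_triangle_def card_3_iff)
  have less: "v < n" "x < n" "y < n" using assms S by (auto simp: is_triangle_def)
  define p where "p = int v"
  have p: "vertex p = v" using less by (simp add: p_def vertex_of_nat)
  obtain q where q: "p \<le> q" "q < p + N" "vertex q = x" using vertex_lift less by blast
  obtain r where r: "p \<le> r" "r < p + N" "vertex r = y" using vertex_lift less by blast
  have *: "{vertex p, vertex q} \<in> qverts n \<sigma>" "{vertex q, vertex r} \<in> qverts n \<sigma>" "{vertex p, vertex r} \<in> qverts n \<sigma>"
    "{vertex r, vertex q} \<in> qverts n \<sigma>"
    using assms S p q r by (auto simp: is_triangle_def)
  consider "q < r" | "r < q" using S q r by fastforce
  then show ?thesis
  proof cases
    case 1
    then have "ltriangle p q r" unfolding ltriangle_def using * S p q r by (auto intro!: chord_of_vertex)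
    then show ?thesis using that S p q r by blast
  next
    case 2
    then have "ltriangle p r q" unfolding ltriangle_def using * S p q r by (auto intro!: chord_of_vertex)
    then show ?thesis using that[of p r q] S p q r by auto
  qed
qed

text \<open>Arrows are encoded by source and target alone and \<open>theta_arrow\<close> tests for
  external arrows first, so the two kinds must be disjoint. A coincidence would put \<open>q\<close>
  just before \<open>p + N\<close> and leave no room for \<open>r\<close>.\<close>

lemma internal_not_external:
  assumes "ltriangle p q r" shows "\<not> external_arrow n \<sigma> (edge_of (p, q), edge_of (p, r))"
proof
  assume "external_arrow n \<sigma> (edge_of (p, q), edge_of (p, r))"
  then obtain v where v: "{vertex p, vertex q} = {vertex (v - 1), vertex v}" "{vertex p, vertex r} = {vertex v, vertex (v + 1)}"
    by (auto simp: external_arrow_iff edge_of_pair)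
  have ne: "vertex p \<noteq> vertex q" "vertex q \<noteq> vertex r" "vertex p \<noteq> vertex r"
    using assms by (auto simp: ltriangle_def chord_def intro: vertex_neq dest!: vertex_neq)
  have "vertex p = vertex v"
    using v ne by (auto simp: doubleton_eq_iff)
  moreover have "vertex q = vertex (v - 1)"
    using v ne calculation by (auto simp: doubleton_eq_iff)
  ultimately have "vertex q = vertex (p - 1 + N)"
    using vertex_add_cong[of p v "-1"] by (simp del: int_vertex)
  then have "q = p - 1 + N" using ltriangle_less[OF assms] by (intro vertex_inj) auto
  then show False using ltriangle_less[OF assms] by simp
qed

lemma theta_internal:
  assumes "ltriangle p q r"
  shows "int (theta_arrow n \<sigma> (edge_of (p, q), edge_of (p, r))) = r - q"
proof -
  have ne: "vertex p \<noteq> vertex q" "vertex q \<noteq> vertex r" "vertex p \<noteq> vertex r"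
    using assms by (auto simp: ltriangle_def chord_def intro: vertex_neq dest!: vertex_neq)
  have "edge_of (p, q) \<inter> edge_of (p, r) = {vertex p}" "edge_of (p, q) - {vertex p} = {vertex q}" "edge_of (p, r) - {vertex p} = {vertex r}"
    using ne by (auto simp: edge_of_pair)
  then have "theta_arrow n \<sigma> (edge_of (p, q), edge_of (p, r)) = ccw_off n (vertex p) (vertex r) - ccw_off n (vertex p) (vertex q)"
    using internal_not_external[OF assms] by (simp add: theta_arrow_def Let_def)
  moreover have "int (ccw_off n (vertex p) (vertex q)) = q - p" "int (ccw_off n (vertex p) (vertex r)) = r - p"
    using ltriangle_less[OF assms] by (auto intro: ccw_off_vertex)
  ultimately show ?thesis using ltriangle_less[OF assms] by linarith
qed

text \<open>Lifted arrows: \<open>first\<close> and \<open>second\<close> are internal arrows turning about the first or second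
  endpoint of the source, \<open>ext\<close> and \<open>ext'\<close> are external arrows whose polygon vertex is the second
  or first endpoint of the source.\<close>

inductive step :: "int \<times> int \<Rightarrow> int \<times> int \<Rightarrow> bool" where
  first: "ltriangle p q r \<Longrightarrow> step (p, q) (p, r)"
| second: "ltriangle p r q \<Longrightarrow> step (p, q) (r, q)"
| ext: "has_diagonal q \<Longrightarrow> step (q - 1, q) (q, q + 1)"
| ext': "has_diagonal p \<Longrightarrow> step (p, p + N - 1) (p + 1, p + N)"

lemma step_\<tau>: "step x y \<Longrightarrow> step (\<tau> x) (\<tau> y)"
proof (induction rule: step.induct)
  case (first p q r)
  then show ?case using step.second[of q r "p + N"] by (simp add: ltriangle_rot)
next
  case (second p r q)
  then show ?case using step.first[of q "p + N" "r + N"] by (simp add: ltriangle_rot)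
next
  case (ext q)
  then show ?case using step.ext'[of q] by (simp add: algebra_simps)
next
  case (ext' p)
  then show ?case using step.ext[of "p + N"] has_diagonal_cong[of p "p + N"] by (simp add: algebra_simps)
qed

lemma edge_of_reduce: "edge_of (q - N, p) = edge_of (p, q)"
  by (auto simp: edge_of_pair)

lemma step_props:
  assumes "step x y"
  shows step_lifted_source: "lifted x" and step_lifted_target: "lifted y" and step_arrow: "(edge_of x, edge_of y) \<in> qarrows n \<sigma>"
    and step_theta: "int (theta_arrow n \<sigma> (edge_of x, edge_of y)) = height y - height x"
    and step_mono: "fst x \<le> fst y" "snd x \<le> snd y" and step_height: "height x < height y"
proof -
  have "lifted x \<and> lifted y \<and> (edge_of x, edge_of y) \<in> qarrows n \<sigma> \<and> int (theta_arrow n \<sigma> (edge_of x, edge_of y)) = height y - height x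
    \<and> fst x \<le> fst y \<and> snd x \<le> snd y \<and> height x < height y"
    using assms
  proof (induction rule: step.induct)
    case (first p q r)
    then have "internal_arrow n \<sigma> (edge_of (p, q), edge_of (p, r))" using internal_arrow_iff by blast
    then show ?case using first ltriangle_less[OF first] theta_internal[OF first]
      by (auto simp: qarrows_def ltriangle_def)
  next
    case (second p r q)
    have t: "ltriangle (q - N) p r" using second ltriangle_rot' by blast
    then have "internal_arrow n \<sigma> (edge_of (p, q), edge_of (r, q))" using internal_arrow_iff edge_of_reduce by metis
    then show ?case using second ltriangle_less[OF second] theta_internal[OF t]
      by (auto simp: qarrows_def ltriangle_def edge_of_reduce)
  next
    case (ext q)
    then have "external_arrow n \<sigma> (edge_of (q - 1, q), edge_of (q, q + 1))" using external_arrow_iff by blast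
    then show ?case using chord_side[of q] chord_side[of "q - 1"] by (auto simp: theta_arrow_def qarrows_def)
  next
    case (ext' p)
    have "edge_of (p, p + N - 1) = edge_of (p - 1, p)" "edge_of (p + 1, p + N) = edge_of (p, p + 1)"
      using edge_of_reduce[of "p + N - 1" p] edge_of_reduce[of "p + N" "p + 1"] by (simp_all add: algebra_simps)
    moreover have "external_arrow n \<sigma> (edge_of (p - 1, p), edge_of (p, p + 1))" using ext' external_arrow_iff by blast
    moreover have "chord p (p + N - 1)" "chord (p + 1) (p + N)"
      using chord_tau[of p "p - 1"] chord_tau[of "p + 1" p] chord_side[of p] chord_side[of "p - 1"]
      by (simp_all add: algebra_simps)
    ultimately show ?case by (auto simp: theta_arrow_def qarrows_def)
  qed
  then show "lifted x" "lifted y" "(edge_of x, edge_of y) \<in> qarrows n \<sigma>"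
    "int (theta_arrow n \<sigma> (edge_of x, edge_of y)) = height y - height x" "fst x \<le> fst y" "snd x \<le> snd y" "height x < height y"
    by auto
qed

section \<open>Lifting edges and arrows\<close>

lemma vertex_eq_shift: "vertex p = vertex q \<Longrightarrow> \<exists>k. q = p + k * N"
  by (elim vertex_eqE) blast

text \<open>The two alternatives are the even and the odd powers of \<open>\<tau>\<close>. Hence
  heights of lifts of one edge differ by multiples of \<open>N\<close>, and the height identifies
  the lift.\<close>

lemma edge_of_eq_cases:
  assumes "lifted x" "lifted y" "edge_of x = edge_of y"
  obtains k where "y = (fst x + k * N, snd x + k * N)"
  | k where "y = (snd x + k * N, fst x + N + k * N)"
proof -
  obtain p q c d where xy: "x = (p, q)" "y = (c, d)" by (cases x, cases y)
  have l: "p < q" "q < p + N" "c < d" "d < c + N" using assms xy chord_less by auto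
  consider "vertex p = vertex c" "vertex q = vertex d" | "vertex q = vertex c" "vertex p = vertex d"
    using assms(3) by (auto simp: xy edge_of_pair doubleton_eq_iff)
  then show ?thesis
  proof cases
    case 1
    then obtain k where k: "c = p + k * N" using vertex_eq_shift by blast
    then have "d = q + k * N"
      using 1 l by (intro vertex_inj) auto
    then show ?thesis using that(1)[of k] k xy by simp
  next
    case 2
    then obtain k where k: "c = q + k * N" using vertex_eq_shift by blast
    have "vertex (p + N + k * N) = vertex p" using vertex_shift_mult vertex_shift by presburger
    then have "d = p + N + k * N"
      using 2 l k by (intro vertex_inj) auto
    then show ?thesis using that(2)[of k] k xy by simp
  qed
qed

lemma edge_of_height_cong:
  assumes "lifted x" "lifted y" "edge_of x = edge_of y"
  shows "\<exists>m. height y = height x + m * N"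
  using assms
proof (cases rule: edge_of_eq_cases)
  case (1 k)
  then show ?thesis by (intro exI[of _ "2 * k"]) (simp add: height_def)
next
  case (2 k)
  then show ?thesis by (intro exI[of _ "2 * k + 1"]) (simp add: height_def algebra_simps)
qed

lemma edge_of_height_inj:
  assumes "lifted x" "lifted y" "edge_of x = edge_of y" "height x = height y"
  shows "x = y"
  using assms(1-3)
proof (cases rule: edge_of_eq_cases)
  case (1 k)
  then show ?thesis using assms(4) N3 by (auto simp: height_def prod_eq_iff)
next
  case (2 k)
  then have "(2 * k + 1) * N = 0" using assms(4) by (simp add: height_def algebra_simps)
  then show ?thesis using N3 by (auto; presburger)
qed

lemma edge_of_lift:
  assumes "e \<in> qverts n \<sigma>" obtains x where "lifted x" "edge_of x = e"
proof -
  have "\<exists>a\<in>e. a < n"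
  proof (cases "e \<in> \<sigma>")
    case True
    then show ?thesis by (elim diagonal_elim) auto
  qed (use assms in \<open>auto simp: qverts_def poly_side_iff\<close>)
  then obtain a where "a \<in> e" "a < n" by blast
  then show ?thesis using that edge_lift[OF assms, of a "int a"] vertex_of_nat
    by (metis lifted_pair edge_of_pair)
qed

text \<open>The vertex about which the arrow turns may be the first or the second end of the given
  lift; this yields \<open>first\<close> or \<open>second\<close> for internal arrows, and
  \<open>ext'\<close> or \<open>ext\<close> for external ones.\<close>

lemma arrow_lift:
  assumes a: "a \<in> qarrows n \<sigma>" and x: "lifted x" "edge_of x = fst a"
  obtains y where "step x y" "edge_of y = snd a"
proof -
  obtain s t where xst: "x = (s, t)" by (cases x)
  have st: "s < t" "t < s + N" using x chord_less by (auto simp: xst)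
  consider "internal_arrow n \<sigma> a" | "external_arrow n \<sigma> a" using a by (auto simp: qarrows_def)
  then have "\<exists>y. step x y \<and> edge_of y = snd a"
  proof cases
    case 1
    then obtain p q r where ltriangle: "ltriangle p q r" and a: "a = (edge_of (p, q), edge_of (p, r))"
      using internal_arrow_iff by blast
    have l: "p < q" "q < r" "r < p + N" using ltriangle_less[OF ltriangle] by auto
    consider "vertex p = vertex s" "vertex q = vertex t" | "vertex p = vertex (t - N)" "vertex q = vertex s"
      using x(2) by (auto simp: a xst edge_of_pair doubleton_eq_iff)
    then show ?thesis
    proof cases
      case 1
      then obtain k where k: "s = p + k * N" using vertex_eq_shift by blast
      then have t: "t = q + k * N" using 1 l st by (intro vertex_inj) auto
      then have "ltriangle s t (r + k * N)" using ltriangle k ltriangle_shift by simp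
      then have "step x (s, r + k * N)" unfolding xst by (rule step.first)
      moreover have "edge_of (s, r + k * N) = snd a" using 1(1) by (simp add: a edge_of_pair)
      ultimately show ?thesis by blast
    next
      case 2
      then obtain k where k: "t - N = p + k * N" using vertex_eq_shift by blast
      then have t: "s = q + k * N" using 2 l st by (intro vertex_inj) auto
      then have "ltriangle (t - N) s (r + k * N)" using ltriangle k ltriangle_shift by simp
      then have "ltriangle s (r + k * N) t" using ltriangle_rot' by blast
      then have "step x (r + k * N, t)" unfolding xst by (rule step.second)
      moreover have "edge_of (r + k * N, t) = snd a" using 2(1) by (auto simp: a edge_of_pair)
      ultimately show ?thesis by blast
    qed
  next
    case 2
    then obtain v where has_diagonal: "has_diagonal v" and a: "a = (edge_of (v - 1, v), edge_of (v, v + 1))"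
      using external_arrow_iff by blast
    consider "vertex v = vertex t" "vertex (v - 1) = vertex s" | "vertex v = vertex s" "vertex (v - 1) = vertex t"
      using x(2) by (auto simp: a xst edge_of_pair doubleton_eq_iff)
    then show ?thesis
    proof cases
      case 1
      then have "vertex s = vertex (t - 1)" using vertex_add_cong[of v t "-1"] by simp
      then have s: "s = t - 1" using st by (intro vertex_inj) auto
      have "has_diagonal t" using has_diagonal has_diagonal_cong 1 by blast
      then have "step x (t, t + 1)" unfolding xst s by (rule step.ext)
      moreover have "edge_of (t, t + 1) = snd a"
        using 1(1) vertex_add_cong[OF 1(1), of 1] by (simp add: a edge_of_pair)
      ultimately show ?thesis by blast
    next
      case 2
      then have "vertex t = vertex (s - 1 + N)" using vertex_add_cong[OF 2(1), of "-1"] by (simp only: vertex_shift) simp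
      then have "t = s - 1 + N" using st by (intro vertex_inj) auto
      then have t: "t = s + N - 1" by simp
      have "has_diagonal s" using has_diagonal has_diagonal_cong 2 by blast
      then have "step x (s + 1, s + N)" unfolding xst t by (rule step.ext')
      moreover have "edge_of (s + 1, s + N) = snd a"
        using 2(1) vertex_add_cong[OF 2(1), of 1] by (auto simp: a edge_of_pair)
      ultimately show ?thesis by blast
    qed
  qed
  then show ?thesis using that by blast
qed

section \<open>Lifted paths\<close>

text \<open>The path runs in the cover, but the list stores the projected arrows. The same list thus
  serves as a path of the quiver and for every translate under \<open>\<tau>\<close>.\<close>

fun lpath :: "int \<times> int \<Rightarrow> arrow list \<Rightarrow> int \<times> int \<Rightarrow> bool" where
  "lpath x [] y \<longleftrightarrow> x = y"
| "lpath x (a # as) y \<longleftrightarrow> (\<exists>z. step x z \<and> a = (edge_of x, edge_of z) \<and> lpath z as y)"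

lemma lpath_append: "lpath x (as @ bs) z \<longleftrightarrow> (\<exists>y. lpath x as y \<and> lpath y bs z)"
  by (induction as arbitrary: x) auto

lemma lpath_\<tau>: "lpath x as y \<Longrightarrow> lpath (\<tau> x) as (\<tau> y)"
proof (induction as arbitrary: x)
  case (Cons a as)
  then obtain z where "step x z" "a = (edge_of x, edge_of z)" "lpath z as y" by auto
  then have "step (\<tau> x) (\<tau> z)" "a = (edge_of (\<tau> x), edge_of (\<tau> z))" "lpath (\<tau> z) as (\<tau> y)"
    using Cons.IH step_\<tau> by simp_all
  then show ?case unfolding lpath.simps by blast
qed auto

lemma lpath_mono: "lpath x as y \<Longrightarrow> fst x \<le> fst y \<and> snd x \<le> snd y"
proof (induction as arbitrary: x)
  case (Cons a as)
  then obtain z where "step x z" "lpath z as y" by auto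
  then show ?case using Cons.IH[of z] step_mono[of x z] by auto
qed auto

lemma lpath_lifted: "lpath x as y \<Longrightarrow> lifted x \<longleftrightarrow> lifted y"
  by (induction as arbitrary: x) (auto dest: step_lifted_source step_lifted_target)

lemma lpath_theta: "lpath x as y \<Longrightarrow> int (theta_len n \<sigma> (s, as)) = height y - height x"
  by (induction as arbitrary: x) (auto simp: theta_len_def dest: step_theta)

lemma lpath_path_from_to:
  assumes "lifted x" "lpath x as y" shows "path_from_to n \<sigma> (edge_of x) (edge_of y) (edge_of x, as)"
  using assms
proof (induction as arbitrary: x)
  case Nil
  then show ?case by (simp add: path_from_to_def valid_path_def pstart_def pend_def edge_of_qverts)
next
  case (Cons a as)
  then obtain z where z: "step x z" "a = (edge_of x, edge_of z)" "lpath z as y" by auto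
  then have "path_from_to n \<sigma> (edge_of z) (edge_of y) (edge_of z, as)" using Cons step_lifted_target by blast
  moreover have "edge_of x \<in> qverts n \<sigma>" using Cons.prems edge_of_qverts by blast
  ultimately show ?case using z(2) step_arrow[OF z(1)]
    by (simp add: path_from_to_def valid_path_def pstart_def pend_def split: if_splits)
qed

lemma lpath_exists:
  assumes "valid_path n \<sigma> (s, as)" "lifted x" "edge_of x = s"
  obtains y where "lpath x as y" "edge_of y = pend (s, as)" "lifted y"
proof -
  have "\<exists>y. lpath x as y" using assms
  proof (induction as arbitrary: s x)
    case (Cons a as)
    obtain z where z: "step x z" "edge_of z = snd a"
      using arrow_lift[of a x] Cons.prems by (auto simp: valid_path_def)
    have "\<exists>y. lpath z as y"
      by (rule Cons.IH[of "edge_of z"])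
        (use Cons.prems z edge_of_qverts[OF step_lifted_target[OF z(1)]] in \<open>auto simp: valid_path_def step_lifted_target\<close>)
    then obtain y where "lpath z as y" by blast
    moreover have "a = (edge_of x, edge_of z)" using z Cons.prems by (simp add: valid_path_def prod_eq_iff)
    ultimately show ?case unfolding lpath.simps using z by blast
  qed auto
  then obtain y where y: "lpath x as y" by blast
  then have "lifted y" "edge_of y = pend (s, as)"
    using lpath_lifted lpath_path_from_to[OF assms(2) y] assms by (auto simp: path_from_to_def)
  then show ?thesis using that y by blast
qed

section \<open>Connectivity in the componentwise order\<close>

lemma ltriangle_exists':
  assumes "chord p q" "q + 1 < p + N"
  obtains r where "ltriangle p q r"
  using ltriangle_exists[of q "p + N"] assms chord_tau ltriangle_rot by metis

definition dominates :: "int \<times> int \<Rightarrow> int \<times> int \<Rightarrow> bool" where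
  "dominates x y \<longleftrightarrow> fst x \<le> fst y \<and> snd x \<le> snd y"

lemma dominates_pair [simp]: "dominates (p, q) (c, d) \<longleftrightarrow> p \<le> c \<and> q \<le> d"
  by (simp add: dominates_def)

lemma dominates_\<tau> [simp]: "dominates (\<tau> x) (\<tau> y) \<longleftrightarrow> dominates x y"
  by (auto simp: dominates_def \<tau>_def)

text \<open>If the turn about \<open>p\<close> overshoots, that is \<open>d < r\<close>, then
  \<open>c = p\<close> is impossible because \<open>(p, d)\<close> would cross
  \<open>(q, r)\<close>. Moreover \<open>q < d < r\<close> makes \<open>(q, r)\<close> a diagonal,
  so the external arrow at \<open>q\<close> exists and stays below \<open>(c, d)\<close>.\<close>

lemma step_exists_side:
  assumes "chord c d" "p \<le> c" "p + 1 \<le> d" "(c, d) \<noteq> (p, p + 1)"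
  shows "\<exists>z. step (p, p + 1) z \<and> dominates z (c, d)"
proof -
  define q where "q = p + 1"
  obtain r where r: "ltriangle p q r" using ltriangle_exists'[of p q] chord_side N3 by (auto simp: q_def)
  have l: "q < r" "r < p + N" using ltriangle_less[OF r] by auto
  show ?thesis
  proof (cases "r \<le> d")
    case True
    then show ?thesis using step.first[OF r] assms by (intro exI[of _ "(p, r)"]) (simp add: q_def)
  next
    case False
    have "c < d" using chord_less assms by blast
    have d: "q < d" using assms \<open>c < d\<close> by (auto simp: q_def)
    have "c \<noteq> p" using chord_noncrossing[of p d q r] assms(1) r d False l by (auto simp: ltriangle_def q_def)
    then have c: "q \<le> c" using assms by (simp add: q_def)
    have "has_diagonal q" unfolding has_diagonal_iff
      using r l d False by (intro exI[of _ r]) (auto simp: ltriangle_def q_def)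
    then have "step (p, p + 1) (q, q + 1)" using step.ext[of q] by (simp add: q_def)
    then show ?thesis using c d by (intro exI[of _ "(q, q + 1)"]) simp
  qed
qed

lemma \<tau>_obtain: obtains y' where "y = \<tau> y'"
proof
  show "y = \<tau> (snd y - N, fst y)" by (simp add: \<tau>_def)
qed

lemma step_exists:
  assumes "lifted x" "lifted y" "dominates x y" "x \<noteq> y"
  shows "\<exists>z. step x z \<and> dominates z y"
proof -
  obtain p q c d where xy: "x = (p, q)" "y = (c, d)" by (cases x, cases y)
  have chord: "chord p q" "chord c d" "p \<le> c" "q \<le> d" using assms by (auto simp: xy)
  have l: "p < q" "q < p + N" "c < d" "d < c + N" using chord chord_less by auto
  consider "q = p + 1" | "q = p + N - 1" | "p + 1 < q" "q + 1 < p + N" using l by linarith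
  then show ?thesis
  proof cases
    case 1
    then show ?thesis using step_exists_side[of c d p] chord assms xy by auto
  next
    case 2
    obtain y' where y': "y = \<tau> y'" by (rule \<tau>_obtain)
    \<comment> \<open>This is a side seen from its other end; the inverse of \<open>\<tau>\<close>
      reduces it to gap 1.\<close>
    have x': "x = \<tau> (p - 1, p - 1 + 1)" using 2 xy by simp
    have "lifted y'" "dominates (p - 1, p - 1 + 1) y'" "y' \<noteq> (p - 1, p - 1 + 1)"
      using assms unfolding y' x' lifted_\<tau> dominates_\<tau> by blast+
    then obtain z where "step (p - 1, p - 1 + 1) z" "dominates z y'"
      using step_exists_side[of "fst y'" "snd y'" "p - 1"] by (auto simp: dominates_def lifted_def)
    then show ?thesis unfolding x' y' using step_\<tau> dominates_\<tau> by blast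
  next
    case 3
    obtain r where r: "ltriangle p q r" using ltriangle_exists' chord 3 by blast
    obtain r' where r': "ltriangle p r' q" using ltriangle_exists chord 3 by blast
    have o: "p < r'" "r' < q" "q < r" "r < p + N" using ltriangle_less[OF r] ltriangle_less[OF r'] by auto
    consider "r \<le> d" | "r' \<le> c" | "d < r" "c < r'" by linarith
    then show ?thesis
    proof cases
      case 1
      then show ?thesis using step.first[OF r] chord xy by (intro exI[of _ "(p, r)"]) simp
    next
      case 2
      then show ?thesis using step.second[OF r'] chord xy by (intro exI[of _ "(r', q)"]) simp
    next
      case 3
      \<comment> \<open>Both turns cannot overshoot: for \<open>p < c\<close> the chord
        \<open>(c, d)\<close> crosses \<open>(p, r')\<close>, and for \<open>c = p\<close> the chord
        \<open>(p, d)\<close> crosses \<open>(q, r)\<close>.\<close>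
      have False if "p < c" using that chord_noncrossing[of p r' c d] r' chord 3 o by (auto simp: ltriangle_def)
      then have "c = p" using chord(3) by fastforce
      then have "q < d" using chord assms(4) xy by auto
      then have False using \<open>c = p\<close> chord_noncrossing[of p d q r] r chord 3 o by (auto simp: ltriangle_def)
      then show ?thesis ..
    qed
  qed
qed

lemma lpath_ConsI: "step x z \<Longrightarrow> lpath z as y \<Longrightarrow> lpath x ((edge_of x, edge_of z) # as) y"
  unfolding lpath.simps by blast

lemma lpath_connected:
  assumes "lifted x" "lifted y" "dominates x y"
  shows "\<exists>as. lpath x as y"
  using assms
proof (induction "nat (height y - height x)" arbitrary: x rule: less_induct)
  case less
  show ?case
  proof (cases "x = y")
    case True
    then have "lpath x [] y" by simp
    then show ?thesis ..
  next
    case False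
    then obtain z where z: "step x z" "dominates z y" using step_exists less.prems by blast
    have "nat (height y - height z) < nat (height y - height x)"
      using step_height[OF z(1)] z(2) by (auto simp: dominates_def height_def)
    then obtain as where "lpath z as y" using less.hyps less.prems z step_lifted_target by blast
    then have "lpath x ((edge_of x, edge_of z) # as) y" using z(1) lpath_ConsI by blast
    then show ?thesis ..
  qed
qed

section \<open>Turns about an endpoint, and fans around a polygon vertex\<close>

text \<open>The turn about the first endpoint. The external step belongs here because its target
  \<open>(p + 1, p + N)\<close> still contains the vertex of \<open>p\<close>, now in second place.
  Each lift has at most one such turn about each end.\<close>

definition rot1 :: "int \<Rightarrow> int \<Rightarrow> int \<times> int \<Rightarrow> bool" where
  "rot1 p q z \<longleftrightarrow> (\<exists>r. ltriangle p q r \<and> z = (p, r)) \<or> q = p + N - 1 \<and> has_diagonal p \<and> z = (p + 1, p + N)"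

definition rot2 :: "int \<Rightarrow> int \<Rightarrow> int \<times> int \<Rightarrow> bool" where
  "rot2 p q z \<longleftrightarrow> (\<exists>r. ltriangle p r q \<and> z = (r, q)) \<or> q = p + 1 \<and> has_diagonal q \<and> z = (q, q + 1)"

lemma step_rot: "step (p, q) z \<longleftrightarrow> rot1 p q z \<or> rot2 p q z"
proof
  assume "step (p, q) z"
  then show "rot1 p q z \<or> rot2 p q z"
    by cases (auto simp: rot1_def rot2_def)
next
  assume "rot1 p q z \<or> rot2 p q z"
  then show "step (p, q) z"
    unfolding rot1_def rot2_def
    using step.intros(1,2) step.ext[of q] step.ext'[of p] by auto
qed

lemma rot1_unique: "rot1 p q z \<Longrightarrow> rot1 p q z' \<Longrightarrow> z = z'"
  unfolding rot1_def by (auto dest: ltriangle_unique ltriangle_less)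

lemma rot2_unique: "rot2 p q z \<Longrightarrow> rot2 p q z' \<Longrightarrow> z = z'"
  unfolding rot2_def by (auto dest: ltriangle_unique' ltriangle_less)

lemma rot1_notin: "rot1 p q z \<Longrightarrow> vertex q \<notin> edge_of z"
  unfolding rot1_def
proof (elim disjE exE conjE)
  fix r assume "ltriangle p q r" "z = (p, r)"
  then show ?thesis using vertex_neq[of p q] vertex_neq[of q r] by (auto simp: edge_of_pair ltriangle_def chord_def)
next
  assume *: "q = p + N - 1" "z = (p + 1, p + N)"
  have "vertex (p + 1) \<noteq> vertex q" "vertex q \<noteq> vertex (p + N)" using N3 * by (intro vertex_neq; simp)+
  then show ?thesis using * by (auto simp: edge_of_pair)
qed

lemma rot2_notin: "rot2 p q z \<Longrightarrow> vertex p \<notin> edge_of z"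
  unfolding rot2_def
proof (elim disjE exE conjE)
  fix r assume "ltriangle p r q" "z = (r, q)"
  then show ?thesis using vertex_neq[of p q] vertex_neq[of p r] by (auto simp: edge_of_pair ltriangle_def chord_def)
next
  assume *: "q = p + 1" "z = (q, q + 1)"
  have "vertex p \<noteq> vertex q" "vertex p \<noteq> vertex (q + 1)" using N3 * by (intro vertex_neq; simp)+
  then show ?thesis using * by (auto simp: edge_of_pair)
qed

lemma step_around_unique:
  assumes "step x z" "step x z'" "v \<in> edge_of x" "v \<in> edge_of z" "v \<in> edge_of z'"
  shows "z = z'"
proof -
  obtain p q where x: "x = (p, q)" by (cases x)
  have "rot1 p q z \<and> rot1 p q z' \<or> rot2 p q z \<and> rot2 p q z'"
    using assms rot1_notin[of p q z] rot1_notin[of p q z'] rot2_notin[of p q z] rot2_notin[of p q z']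
    by (simp add: x step_rot edge_of_pair) blast
  then show ?thesis using rot1_unique rot2_unique by blast
qed

lemma lpath_height: "lpath x as y \<Longrightarrow> height x \<le> height y \<and> (as \<noteq> [] \<longrightarrow> height x < height y)"
proof (induction as arbitrary: x)
  case (Cons a as)
  then obtain z where "step x z" "lpath z as y" by auto
  then show ?case using Cons.IH[of z] step_height[of x z] by auto
qed auto

definition around :: "int \<Rightarrow> arrow list \<Rightarrow> bool" where
  "around v as \<longleftrightarrow> (\<forall>a\<in>set as. vertex v \<in> fst a \<and> vertex v \<in> snd a)"

lemma around_simps [simp]:
  "around v []"
  "around v (a # as) \<longleftrightarrow> vertex v \<in> fst a \<and> vertex v \<in> snd a \<and> around v as"
  "around v (as @ bs) \<longleftrightarrow> around v as \<and> around v bs"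
  by (auto simp: around_def)

text \<open>Turning about a fixed vertex leaves no choice at any step. This makes the remainder of a
  big cycle unique.\<close>

lemma lpath_around_unique:
  "lpath x as y \<Longrightarrow> lpath x bs y \<Longrightarrow> around v as \<Longrightarrow> around v bs \<Longrightarrow> as = bs"
proof (induction as arbitrary: x bs)
  case Nil
  then show ?case using lpath_height by fastforce
next
  case (Cons a as)
  then obtain z where z: "step x z" "a = (edge_of x, edge_of z)" "lpath z as y" by auto
  have "bs \<noteq> []" using lpath_height[OF Cons.prems(1)] Cons.prems(2) by auto
  then obtain b bs' where bs: "bs = b # bs'" by (cases bs) auto
  obtain z' where z': "step x z'" "b = (edge_of x, edge_of z')" "lpath z' bs' y" using Cons.prems bs by auto
  have "z = z'" using step_around_unique[OF z(1) z'(1)] Cons.prems z z' bs by auto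
  then show ?case using Cons z z' bs by auto
qed

definition ext_count :: "arrow list \<Rightarrow> nat" where
  "ext_count as = length (filter (external_arrow n \<sigma>) as)"

lemma ext_count_simps [simp]:
  "ext_count [] = 0"
  "ext_count (a # as) = (if external_arrow n \<sigma> a then Suc (ext_count as) else ext_count as)"
  "ext_count (as @ bs) = ext_count as + ext_count bs"
  by (simp_all add: ext_count_def)

lemma second_not_external: "ltriangle p r q \<Longrightarrow> \<not> external_arrow n \<sigma> (edge_of (p, q), edge_of (r, q))"
  using internal_not_external[of "q - N" p r] by (simp add: ltriangle_rot' edge_of_reduce)

lemma ext_external: "has_diagonal q \<Longrightarrow> external_arrow n \<sigma> (edge_of (q - 1, q), edge_of (q, q + 1))"
  using external_arrow_iff by blast

lemma ext'_external: "has_diagonal p \<Longrightarrow> external_arrow n \<sigma> (edge_of (p, p + N - 1), edge_of (p + 1, p + N))"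
  using ext_external[of p] edge_of_reduce[of "p + N - 1" p] edge_of_reduce[of "p + N" "p + 1"]
  by (simp add: algebra_simps)

lemma lpath_around_no_ext:
  "lpath (v, m) as y \<Longrightarrow> around v as \<Longrightarrow> ext_count as = 0 \<Longrightarrow> \<exists>m'. y = (v, m')"
proof (induction as arbitrary: m)
  case (Cons a as)
  then obtain z where z: "step (v, m) z" "a = (edge_of (v, m), edge_of z)" "lpath z as y" by auto
  have "rot1 v m z" using z Cons.prems(2) rot2_notin[of v m z] by (auto simp: step_rot)
  then consider r where "z = (v, r)" | "m = v + N - 1" "has_diagonal v" "z = (v + 1, v + N)"
    by (auto simp: rot1_def)
  then show ?case
  proof cases
    case 1
    then show ?thesis using Cons z by (auto split: if_splits)
  next
    case 2
    then show ?thesis using Cons.prems z ext'_external by auto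
  qed
qed auto

text \<open>As long as \<open>v\<close> is the second entry, only \<open>rot2\<close> keeps it. The
  external step moves it to the first entry, and it stays there since no second external step is
  allowed. This locates the end of a lifted big cycle.\<close>

lemma lpath_around_one_ext:
  "lpath (m, v) as y \<Longrightarrow> around v as \<Longrightarrow> ext_count as = 1 \<Longrightarrow> \<exists>m'. y = (v, m')"
proof (induction as arbitrary: m)
  case (Cons a as)
  then obtain z where z: "step (m, v) z" "a = (edge_of (m, v), edge_of z)" "lpath z as y" by auto
  have "rot2 m v z" using z Cons.prems(2) rot1_notin[of m v z] by (auto simp: step_rot)
  then consider r where "ltriangle m r v" "z = (r, v)" | "v = m + 1" "has_diagonal v" "z = (v, v + 1)"
    by (auto simp: rot2_def)
  then show ?case
  proof cases
    case 1
    then show ?thesis using Cons z second_not_external by (auto split: if_splits)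
  next
    case 2
    then have "external_arrow n \<sigma> a" using ext_external[of v] z by simp
    then have "ext_count as = 0" using Cons.prems by simp
    then show ?thesis using lpath_around_no_ext[of v "v + 1" as y] z 2 Cons.prems by simp
  qed
qed auto

text \<open>The triangle on the inner side of \<open>(p, v)\<close> supplies each turn about
  \<open>v\<close>; the gap shrinks until the side ending at \<open>v\<close> is reached.\<close>

lemma fan_before:
  "chord p v \<Longrightarrow> \<exists>as. lpath (p, v) as (v - 1, v) \<and> around v as \<and> ext_count as = 0"
proof (induction "nat (v - p)" arbitrary: p rule: less_induct)
  case less
  show ?case
  proof (cases "p = v - 1")
    case True
    then show ?thesis by (intro exI[of _ "[]"]) simp
  next
    case False
    then have "p + 1 < v" using chord_less less.prems by force
    then obtain r where r: "ltriangle p r v" using ltriangle_exists less.prems by blast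
    then have "nat (v - r) < nat (v - p)" "chord r v" using ltriangle_less[OF r] by (auto simp: ltriangle_def)
    then obtain as where as: "lpath (r, v) as (v - 1, v)" "around v as" "ext_count as = 0"
      using less.hyps by blast
    have "lpath (p, v) ((edge_of (p, v), edge_of (r, v)) # as) (v - 1, v)"
      using as step.second[OF r] by auto
    moreover have "around v ((edge_of (p, v), edge_of (r, v)) # as)" using as by (simp add: edge_of_pair)
    moreover have "ext_count ((edge_of (p, v), edge_of (r, v)) # as) = 0"
      using as second_not_external[OF r] by simp
    ultimately show ?thesis by blast
  qed
qed

lemma fan_after:
  "chord v r \<Longrightarrow> \<exists>as. lpath (v, v + 1) as (v, r) \<and> around v as \<and> ext_count as = 0"
proof (induction "nat (r - v)" arbitrary: r rule: less_induct)
  case less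
  show ?case
  proof (cases "r = v + 1")
    case True
    then show ?thesis by (intro exI[of _ "[]"]) simp
  next
    case False
    then have "v + 1 < r" using chord_less less.prems by force
    then obtain m where m: "ltriangle v m r" using ltriangle_exists less.prems by blast
    then have "nat (m - v) < nat (r - v)" "chord v m" using ltriangle_less[OF m] by (auto simp: ltriangle_def)
    then obtain as where as: "lpath (v, v + 1) as (v, m)" "around v as" "ext_count as = 0"
      using less.hyps by blast
    let ?a = "(edge_of (v, m), edge_of (v, r))"
    have "lpath (v, v + 1) (as @ [?a]) (v, r)"
      using as step.first[OF m] by (auto simp: lpath_append)
    moreover have "around v (as @ [?a])" using as by (simp add: edge_of_pair)
    moreover have "ext_count (as @ [?a]) = 0"
      using as internal_not_external[OF m] by simp
    ultimately show ?thesis by blast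
  qed
qed

text \<open>The clauses that include the external arrow serve the case in which the fan begins with
  that arrow.\<close>

lemma fan_from_side:
  assumes "has_diagonal v" "chord v r"
  obtains as where "lpath (v, v + 1) as (v, r)" "around v as" "ext_count as = 0"
    "around v ((edge_of (v - 1, v), edge_of (v, v + 1)) # as)" "ext_count ((edge_of (v - 1, v), edge_of (v, v + 1)) # as) = 1"
proof -
  obtain as where "lpath (v, v + 1) as (v, r)" "around v as" "ext_count as = 0"
    using fan_after assms by blast
  then show ?thesis using that ext_external[OF assms(1)] by (auto simp: edge_of_pair)
qed

lemma fan_exists:
  assumes "has_diagonal v" "chord p v" "chord v r"
  obtains as where "lpath (p, v) as (v, r)" "around v as" "ext_count as = 1"
proof -
  obtain as where as: "lpath (p, v) as (v - 1, v)" "around v as" "ext_count as = 0"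
    using fan_before assms by blast
  let ?a = "(edge_of (v - 1, v), edge_of (v, v + 1))"
  obtain bs where bs: "lpath (v, v + 1) bs (v, r)" "around v (?a # bs)" "ext_count (?a # bs) = 1"
    using fan_from_side[OF assms(1,3)] by metis
  have "step (v - 1, v) (v, v + 1)" using step.ext assms by blast
  then have "lpath (v - 1, v) (?a # bs) (v, r)" using bs by auto
  then have "lpath (p, v) (as @ ?a # bs) (v, r)" using as lpath_append by blast
  moreover have "around v (as @ ?a # bs)" using as bs unfolding around_simps by blast
  moreover have "ext_count (as @ ?a # bs) = 1" using as bs unfolding ext_count_simps(3) by simp
  ultimately show ?thesis using that by blast
qed

text \<open>The relation \<open>rel\<close> is the cyclic derivative with respect to the internal arrow from \<open>{q, r}\<close> to
  \<open>{q, p}\<close>: its left side completes that arrow to a cyclic triangle, its right side to the big cycle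
  around \<open>q\<close>.\<close>

inductive pcong :: "arrow list \<Rightarrow> arrow list \<Rightarrow> bool" where
  rel: "ltriangle p q r \<Longrightarrow> has_diagonal q \<Longrightarrow> lpath (p, q) b (q, r) \<Longrightarrow> around q b \<Longrightarrow> ext_count b = 1 \<Longrightarrow>
    pcong [(edge_of (p, q), edge_of (p, r)), (edge_of (p, r), edge_of (q, r))] b"
| refl: "pcong as as"
| sym: "pcong as bs \<Longrightarrow> pcong bs as"
| trans: "pcong as bs \<Longrightarrow> pcong bs cs \<Longrightarrow> pcong as cs"
| ctxt: "pcong as bs \<Longrightarrow> pcong (us @ as @ vs) (us @ bs @ vs)"

section \<open>Completing two steps, and uniqueness of lifted paths\<close>

lemma pcong_Cons: "pcong as bs \<Longrightarrow> pcong (a # as) (a # bs)"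
  using pcong.ctxt[of as bs "[a]" "[]"] by simp

lemma pcong_append: "pcong as bs \<Longrightarrow> pcong (as @ cs) (bs @ cs)"
  using pcong.ctxt[of as bs "[]" cs] by simp

text \<open>The triangle side of the relation at \<open>q\<close> begins with the turn about
  \<open>p\<close>, its big-cycle side with the turn about \<open>q\<close>. So the two steps out of
  \<open>(p, q)\<close> are the first arrows of its two sides, which meet again at
  \<open>(q, r)\<close>.\<close>

lemma diamond_second:
  assumes "ltriangle p q r" "has_diagonal q" "rot2 p q z"
  obtains as bs where "lpath (p, r) as (q, r)" "lpath z bs (q, r)"
    "pcong ((edge_of (p, q), edge_of (p, r)) # as) ((edge_of (p, q), edge_of z) # bs)"
proof -
  have qr: "chord q r" using assms by (simp add: ltriangle_def)
  have "\<exists>bs. lpath z bs (q, r) \<and> around q ((edge_of (p, q), edge_of z) # bs) \<and> ext_count ((edge_of (p, q), edge_of z) # bs) = 1"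
    using assms(3) unfolding rot2_def
  proof (elim disjE exE conjE)
    fix s assume s: "ltriangle p s q" "z = (s, q)"
    obtain bs where "lpath (s, q) bs (q, r)" "around q bs" "ext_count bs = 1"
      using fan_exists[OF assms(2) _ qr, of s] s by (auto simp: ltriangle_def)
    then show ?thesis using s second_not_external[OF s(1)] by (auto simp: edge_of_pair)
  next
    assume "q = p + 1" "z = (q, q + 1)"
    then show ?thesis using fan_from_side[OF assms(2) qr] by (metis add_diff_cancel_right')
  qed
  then obtain bs where bs: "lpath z bs (q, r)" "around q ((edge_of (p, q), edge_of z) # bs)"
    "ext_count ((edge_of (p, q), edge_of z) # bs) = 1" by blast
  moreover have "step (p, q) z" using assms step_rot by blast
  ultimately have "lpath (p, q) ((edge_of (p, q), edge_of z) # bs) (q, r)" using lpath_ConsI by blast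
  then have "pcong [(edge_of (p, q), edge_of (p, r)), (edge_of (p, r), edge_of (q, r))] ((edge_of (p, q), edge_of z) # bs)"
    using pcong.rel assms bs by blast
  moreover have "lpath (p, r) [(edge_of (p, r), edge_of (q, r))] (q, r)"
    using step.second[OF assms(1)] by simp
  ultimately show ?thesis using that bs by blast
qed

text \<open>The mirror case: in the lift \<open>(q - N, p)\<close> of the same edge the ends change
  roles, so the relation at \<open>p\<close> follows from the one for second endpoints by applying
  \<open>\<tau>\<close>.\<close>

lemma diamond_first:
  assumes "ltriangle p r q" "has_diagonal p" "rot1 p q z"
  obtains as bs where "lpath (r, q) as (r, p + N)" "lpath z bs (r, p + N)"
    "pcong ((edge_of (p, q), edge_of (r, q)) # as) ((edge_of (p, q), edge_of z) # bs)"
proof -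
  obtain z' where z: "z = \<tau> z'" by (rule \<tau>_obtain)
  have ltriangle: "ltriangle (q - N) p r" using assms(1) ltriangle_rot' by blast
  have "rot2 (q - N) p z'"
    using assms(3) unfolding rot1_def
  proof (elim disjE exE conjE)
    fix s assume s: "ltriangle p q s" "z = (p, s)"
    then have "ltriangle (q - N) (s - N) p" by (simp add: ltriangle_rot')
    moreover have "z' = (s - N, p)" using s z by (auto simp: \<tau>_def prod_eq_iff)
    ultimately show ?thesis unfolding rot2_def by blast
  next
    assume *: "q = p + N - 1" "has_diagonal p" "z = (p + 1, p + N)"
    then have "z' = (p, p + 1)" using z by (auto simp: \<tau>_def prod_eq_iff)
    then show ?thesis unfolding rot2_def using * by simp
  qed
  then obtain as bs where *: "lpath (q - N, r) as (p, r)" "lpath z' bs (p, r)"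
    "pcong ((edge_of (q - N, p), edge_of (q - N, r)) # as) ((edge_of (q - N, p), edge_of z') # bs)"
    using diamond_second[OF ltriangle assms(2)] by blast
  have "lpath (r, q) as (r, p + N)" "lpath z bs (r, p + N)"
    using lpath_\<tau>[OF *(1)] lpath_\<tau>[OF *(2)] z by simp_all
  then show ?thesis using that *(3) z by (simp add: edge_of_reduce)
qed

text \<open>For a diagonal both relations are available, meeting at \<open>(q, r)\<close> and at
  \<open>(r', p + N)\<close>, and the position of \<open>(c, d)\<close> decides which to take. For a
  side with two outgoing steps one relation remains, and its end lies below \<open>(c, d)\<close>
  because it is the componentwise maximum of the two steps' targets.\<close>

lemma diamond_rot:
  assumes "rot1 p q x1" "rot2 p q x2" "chord p q" "chord c d" "dominates x1 (c, d)" "dominates x2 (c, d)"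
  shows "\<exists>z as bs. lpath x1 as z \<and> lpath x2 bs z \<and> dominates z (c, d) \<and>
    pcong ((edge_of (p, q), edge_of x1) # as) ((edge_of (p, q), edge_of x2) # bs)"
proof -
  consider (a) r r' where "ltriangle p q r" "x1 = (p, r)" "ltriangle p r' q" "x2 = (r', q)"
    | (b) r where "ltriangle p q r" "x1 = (p, r)" "q = p + 1" "has_diagonal q" "x2 = (q, q + 1)"
    | (c) r' where "q = p + N - 1" "has_diagonal p" "x1 = (p + 1, p + N)" "ltriangle p r' q" "x2 = (r', q)"
    using assms(1,2) N3 unfolding rot1_def rot2_def by auto
  then show ?thesis
  proof cases
    case a
    have o: "p < r'" "r' < q" "q < r" "r < p + N" using ltriangle_less[OF a(1)] ltriangle_less[OF a(3)] by auto
    have Dp: "has_diagonal p" unfolding has_diagonal_iff using assms(3) o by (intro exI[of _ q]) auto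
    have Dq: "has_diagonal q" unfolding has_diagonal_iff using assms(3) o chord_tau by (intro exI[of _ "p + N"]) auto
    have cd: "r' \<le> c" "r \<le> d" using assms(5,6) a by auto
    \<comment> \<open>Otherwise \<open>(c, d)\<close> crosses \<open>(p, q)\<close>, being beyond both third vertices.\<close>
    consider "q \<le> c" | "p + N \<le> d" using chord_noncrossing[OF assms(3,4)] cd o by fastforce
    then show ?thesis
    proof cases
      case 1
      then have "dominates (q, r) (c, d)" using cd by simp
      then show ?thesis using diamond_second[OF a(1) Dq assms(2)] a(2) by metis
    next
      case 2
      then have "dominates (r', p + N) (c, d)" using cd by simp
      then show ?thesis using diamond_first[OF a(3) Dp assms(1)] a(4) pcong.sym by metis
    qed
  next
    case b
    then have "dominates (q, r) (c, d)" using assms(5,6) by simp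
    then show ?thesis using diamond_second[OF b(1,4) assms(2)] b(2) by metis
  next
    case c
    then have "dominates (r', p + N) (c, d)" using assms(5,6) by simp
    then show ?thesis using diamond_first[OF c(4,2) assms(1)] c(5) pcong.sym by metis
  qed
qed

lemma diamond:
  assumes "step x x1" "step x x2" "x1 \<noteq> x2" "lifted y" "dominates x1 y" "dominates x2 y"
  shows "\<exists>z as bs. lpath x1 as z \<and> lpath x2 bs z \<and> dominates z y \<and>
    pcong ((edge_of x, edge_of x1) # as) ((edge_of x, edge_of x2) # bs)"
proof -
  obtain p q c d where xy: "x = (p, q)" "y = (c, d)" by (cases x, cases y)
  have chord: "chord p q" "chord c d" using step_lifted_source[OF assms(1)] assms xy by auto
  have "rot1 p q x1 \<and> rot2 p q x2 \<or> rot1 p q x2 \<and> rot2 p q x1"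
    using assms(1-3) rot1_unique[of p q x1 x2] rot2_unique[of p q x1 x2] by (simp add: xy step_rot) blast
  then show ?thesis
    using diamond_rot[OF _ _ chord, of x1 x2] diamond_rot[OF _ _ chord, of x2 x1] assms pcong.sym
    unfolding xy by blast
qed

text \<open>An argument as for Newman's lemma, by induction on the height difference. The meeting
  point \<open>z\<close> lies below \<open>y\<close>, so connectivity gives a path \<open>es\<close>
  from \<open>z\<close> to \<open>y\<close>; the induction hypothesis at \<open>x1\<close> and
  \<open>x2\<close> compares the given tails with those through \<open>z\<close>.\<close>

lemma lpath_unique:
  assumes "lpath x as y" "lpath x bs y" "lifted y"
  shows "pcong as bs"
  using assms
proof (induction "nat (height y - height x)" arbitrary: x as bs rule: less_induct)
  case less
  show ?case
  proof (cases "as = [] \<or> bs = []")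
    case True
    then have "x = y" using less.prems by auto
    then have "as = []" "bs = []" using less.prems lpath_height by fastforce+
    then show ?thesis by (simp add: pcong.refl)
  next
    case False
    then obtain a as' b bs' where ab: "as = a # as'" "bs = b # bs'" by (meson list.exhaust)
    obtain x1 where x1: "step x x1" "a = (edge_of x, edge_of x1)" "lpath x1 as' y" using less.prems ab by auto
    obtain x2 where x2: "step x x2" "b = (edge_of x, edge_of x2)" "lpath x2 bs' y" using less.prems ab by auto
    have dec: "nat (height y - height x1) < nat (height y - height x)" "nat (height y - height x2) < nat (height y - height x)"
      using step_height[OF x1(1)] step_height[OF x2(1)] lpath_height[OF x1(3)] lpath_height[OF x2(3)] by auto
    show ?thesis
    proof (cases "x1 = x2")
      case True
      then show ?thesis using less.hyps[OF dec(1) x1(3)] x1 x2 less.prems ab pcong_Cons by auto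
    next
      case False
      have "dominates x1 y" "dominates x2 y" using lpath_mono x1 x2 by (auto simp: dominates_def)
      then obtain z cs ds where z: "lpath x1 cs z" "lpath x2 ds z" "dominates z y"
        "pcong ((edge_of x, edge_of x1) # cs) ((edge_of x, edge_of x2) # ds)"
        using diamond[OF x1(1) x2(1) False less.prems(3)] by blast
      have "lifted z" using lpath_lifted z step_lifted_target x1 by blast
      then obtain es where es: "lpath z es y" using lpath_connected z less.prems by blast
      have "pcong as' (cs @ es)" "pcong bs' (ds @ es)"
        using less.hyps[OF dec(1) x1(3) _ less.prems(3)] less.hyps[OF dec(2) x2(3) _ less.prems(3)] z es
          lpath_append by blast+
      then have "pcong as (a # cs @ es)" "pcong (b # ds @ es) bs"
        using ab pcong_Cons pcong.sym by auto
      moreover have "pcong (a # cs @ es) (b # ds @ es)"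
        using pcong_append[OF z(4), of es] x1 x2 by simp
      ultimately show ?thesis using pcong.trans by blast
    qed
  qed
qed

section \<open>Paths of the quiver and their lifts\<close>

lemma path_lift:
  assumes "valid_path n \<sigma> w" "lifted x" "edge_of x = fst w"
  obtains y where "lpath x (snd w) y" "edge_of y = pend w" "lifted y"
  using lpath_exists[of "fst w" "snd w" x] assms unfolding prod.collapse by blast

lemma pend_qverts:
  assumes "valid_path n \<sigma> p" shows "pend p \<in> qverts n \<sigma>"
proof -
  obtain x where x: "lifted x" "edge_of x = fst p" using edge_of_lift assms by (auto simp: valid_path_def)
  then obtain y where "lifted y" "edge_of y = pend p"
    using path_lift[OF assms] by blast
  then show ?thesis using edge_of_qverts by metis
qed

lemma valid_path_append:
  "valid_path n \<sigma> (s, as @ bs) \<longleftrightarrow> valid_path n \<sigma> (s, as) \<and> valid_path n \<sigma> (pend (s, as), bs)"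
  using pend_qverts[of "(s, as)"] by (auto simp: valid_path_def chain_append)

lemma valid_path_lpath_iff:
  assumes "lifted x" "lpath x l y" "l \<noteq> []"
  shows "valid_path n \<sigma> (s, l) \<longleftrightarrow> s = edge_of x"
proof -
  have "valid_path n \<sigma> (edge_of x, l)" using lpath_path_from_to assms by (auto simp: path_from_to_def)
  moreover have "fst (hd l) = edge_of x" using assms by (cases l) auto
  ultimately show ?thesis using assms(3) by (cases l) (auto simp: valid_path_def)
qed

lemma pend_lpath: "lifted x \<Longrightarrow> lpath x l y \<Longrightarrow> pend (edge_of x, l) = edge_of y"
  using lpath_path_from_to by (auto simp: path_from_to_def)

section \<open>Minimal cycles and cyclic derivatives\<close>

lemma ltriangle_vertex_neq: "ltriangle p q r \<Longrightarrow> vertex p \<noteq> vertex q \<and> vertex q \<noteq> vertex r \<and> vertex p \<noteq> vertex r"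
  using vertex_neq[of p q] vertex_neq[of q r] vertex_neq[of p r] by (auto simp: ltriangle_def chord_def)

text \<open>Exchanging the two other vertices would reverse their anticlockwise order as seen from
  the common one.\<close>

lemma ltriangle_inj_at:
  assumes "ltriangle p q r" "ltriangle u v w" "vertex u = vertex p" "vertex v \<in> {vertex p, vertex q, vertex r}" "vertex w \<in> {vertex p, vertex q, vertex r}"
  shows "vertex v = vertex q \<and> vertex w = vertex r"
proof -
  obtain k where k: "p = u + k * N" using assms(3) vertex_eq_shift by blast
  have o: "u < v" "v < w" "w < u + N" "p < q" "q < r" "r < p + N"
    using ltriangle_less[OF assms(1)] ltriangle_less[OF assms(2)] by auto
  have "vertex v \<noteq> vertex u" "vertex w \<noteq> vertex u" "vertex v \<noteq> vertex w" using ltriangle_vertex_neq[OF assms(2)] by auto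
  then consider "vertex v = vertex q \<and> vertex w = vertex r" | "vertex v = vertex r" "vertex w = vertex q" using assms by auto
  then show ?thesis
  proof cases
    case 2
    then have "v + k * N = r" "w + k * N = q" using o k by (intro vertex_inj; simp)+
    then show ?thesis using o by linarith
  qed
qed

lemma internal_arrow_in_triangle:
  assumes "ltriangle p q r" "internal_arrow n \<sigma> a"
    "fst a \<subseteq> {vertex p, vertex q, vertex r}" "snd a \<subseteq> {vertex p, vertex q, vertex r}"
  shows "a = (edge_of (p, q), edge_of (p, r)) \<or> a = (edge_of (p, r), edge_of (q, r)) \<or> a = (edge_of (q, r), edge_of (p, q))"
proof -
  obtain u v w where ltriangle: "ltriangle u v w" and a: "a = (edge_of (u, v), edge_of (u, w))"
    using assms(2) internal_arrow_iff by blast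
  have T2: "ltriangle q r (p + N)" using assms(1) ltriangle_rot by blast
  then have T3: "ltriangle r (p + N) (q + N)" using ltriangle_rot by blast
  have u: "vertex u \<in> {vertex p, vertex q, vertex r}" and v: "vertex v \<in> {vertex p, vertex q, vertex r}"
    and w: "vertex w \<in> {vertex p, vertex q, vertex r}" using assms(3,4) unfolding a edge_of_pair by auto
  have v': "vertex v \<in> {vertex q, vertex r, vertex (p + N)}" "vertex v \<in> {vertex r, vertex (p + N), vertex (q + N)}"
    and w': "vertex w \<in> {vertex q, vertex r, vertex (p + N)}" "vertex w \<in> {vertex r, vertex (p + N), vertex (q + N)}"
    using v w unfolding vertex_shift by blast+
  consider "vertex u = vertex p" | "vertex u = vertex q" | "vertex u = vertex r" using u by blast
  then show ?thesis
  proof cases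
    case 1
    have "vertex v = vertex q" "vertex w = vertex r"
      using ltriangle_inj_at[OF assms(1) ltriangle 1 v w] unfolding vertex_shift by blast+
    then show ?thesis unfolding a edge_of_pair using 1 by (simp add: insert_commute)
  next
    case 2
    have "vertex v = vertex r" "vertex w = vertex p"
      using ltriangle_inj_at[OF T2 ltriangle 2 v'(1) w'(1)] unfolding vertex_shift by blast+
    then show ?thesis unfolding a edge_of_pair using 2 by (simp add: insert_commute)
  next
    case 3
    have "vertex v = vertex p" "vertex w = vertex q"
      using ltriangle_inj_at[OF T3 ltriangle 3 v'(2) w'(2)] unfolding vertex_shift by blast+
    then show ?thesis unfolding a edge_of_pair using 3 by (simp add: insert_commute)
  qed
qed

definition tricycle :: "int \<Rightarrow> int \<Rightarrow> int \<Rightarrow> arrow list" where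
  "tricycle p q r = [(edge_of (p, q), edge_of (p, r)), (edge_of (p, r), edge_of (q, r)), (edge_of (q, r), edge_of (p, q))]"

lemma lpath_tricycle: "ltriangle p q r \<Longrightarrow> lpath (p, q) (tricycle p q r) (q, p + N)"
proof -
  assume ltriangle: "ltriangle p q r"
  have "step (p, q) (p, r)" "step (p, r) (q, r)" "step (q, r) (q, p + N)"
    using step.first[OF ltriangle] step.second[OF ltriangle] step.first[of q r "p + N"] ltriangle ltriangle_rot by auto
  moreover have "edge_of (q, p + N) = edge_of (p, q)" by (metis edge_of_\<tau> \<tau>_pair)
  ultimately show ?thesis unfolding tricycle_def by (metis lpath.simps(1) lpath_ConsI)
qed

text \<open>The definition only asks for a closed path of three internal arrows inside a triangle. A
  triangle contains exactly three internal arrows, forming an oriented 3-cycle, so only its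
  rotations remain.\<close>

lemma cyclic_triangle_iff:
  "cyclic_triangle n \<sigma> c \<longleftrightarrow> (\<exists>p q r. ltriangle p q r \<and> c = (edge_of (p, q), tricycle p q r))"
proof
  assume c: "cyclic_triangle n \<sigma> c"
  then obtain S where "is_triangle n \<sigma> S" "\<And>a. a \<in> set (snd c) \<Longrightarrow> fst a \<subseteq> S \<and> snd a \<subseteq> S"
    unfolding cyclic_triangle_def by blast
  then obtain p q r where ltriangle: "ltriangle p q r" and S: "\<And>a. a \<in> set (snd c) \<Longrightarrow>
      fst a \<subseteq> {vertex p, vertex q, vertex r} \<and> snd a \<subseteq> {vertex p, vertex q, vertex r}"
    using triangle_lift by metis
  obtain a b d where l: "snd c = [a, b, d]"
    using c by (auto simp: cyclic_triangle_def numeral_3_eq_3 length_Suc_conv)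
  have f: "fst c = fst a" "fst b = snd a" "fst d = snd b"
    using c l by (auto simp: cyclic_triangle_def valid_path_def)
  have int: "x = (edge_of (p, q), edge_of (p, r)) \<or> x = (edge_of (p, r), edge_of (q, r)) \<or> x = (edge_of (q, r), edge_of (p, q))"
    if "x \<in> {a, b, d}" for x
    using that c S l internal_arrow_in_triangle[OF ltriangle, of x] by (auto simp: cyclic_triangle_def)
  have ne: "edge_of (p, q) \<noteq> edge_of (p, r)" "edge_of (p, r) \<noteq> edge_of (q, r)" "edge_of (q, r) \<noteq> edge_of (p, q)"
    using ltriangle_vertex_neq[OF ltriangle] by (auto simp: edge_of_pair doubleton_eq_iff)
  have T2: "ltriangle q r (p + N)" using ltriangle ltriangle_rot by blast
  then have T3: "ltriangle r (p + N) (q + N)" using ltriangle_rot by blast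
  have e: "edge_of (q, p + N) = edge_of (p, q)" "edge_of (r, p + N) = edge_of (p, r)" "edge_of (r, q + N) = edge_of (q, r)"
    "edge_of (p + N, q + N) = edge_of (p, q)"
    by (auto simp: edge_of_pair)
  have "c = (edge_of (p, q), tricycle p q r) \<or> c = (edge_of (q, r), tricycle q r (p + N)) \<or>
      c = (edge_of (r, p + N), tricycle r (p + N) (q + N))"
  proof -
    have c: "c = (fst a, [a, b, d])" using l f by (simp add: prod_eq_iff)
    show ?thesis
      unfolding tricycle_def e c by (rule three_cycle[OF ne]) (use int f(2,3) in simp_all)
  qed
  then show "\<exists>p q r. ltriangle p q r \<and> c = (edge_of (p, q), tricycle p q r)" using ltriangle T2 T3 by blast
next
  assume "\<exists>p q r. ltriangle p q r \<and> c = (edge_of (p, q), tricycle p q r)"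
  then obtain p q r where ltriangle: "ltriangle p q r" and c: "c = (edge_of (p, q), tricycle p q r)" by blast
  have "path_from_to n \<sigma> (edge_of (p, q)) (edge_of (q, p + N)) c"
    using lpath_path_from_to[OF _ lpath_tricycle[OF ltriangle]] ltriangle c by (simp add: ltriangle_def)
  moreover have "edge_of (q, p + N) = edge_of (p, q)" by (auto simp: edge_of_pair)
  moreover have "internal_arrow n \<sigma> (edge_of (p, q), edge_of (p, r))" "internal_arrow n \<sigma> (edge_of (p, r), edge_of (q, r))"
    "internal_arrow n \<sigma> (edge_of (q, r), edge_of (p, q))"
  proof -
    have T2: "ltriangle q r (p + N)" using ltriangle ltriangle_rot by blast
    then have T3: "ltriangle r (p + N) (q + N)" using ltriangle_rot by blast
    have "(edge_of (p, r), edge_of (q, r)) = (edge_of (r, p + N), edge_of (r, q + N))"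
      "(edge_of (q, r), edge_of (p, q)) = (edge_of (q, r), edge_of (q, p + N))" by (auto simp: edge_of_pair)
    then show "internal_arrow n \<sigma> (edge_of (p, q), edge_of (p, r))" "internal_arrow n \<sigma> (edge_of (p, r), edge_of (q, r))"
      "internal_arrow n \<sigma> (edge_of (q, r), edge_of (p, q))" using ltriangle T2 T3 internal_arrow_iff by metis+
  qed
  ultimately show "cyclic_triangle n \<sigma> c"
    unfolding cyclic_triangle_def using ltriangle_is_triangle(1)[OF ltriangle] c
    by (auto simp: path_from_to_def tricycle_def edge_of_pair intro!: exI[of _ "{vertex p, vertex q, vertex r}"])
qed

text \<open>The two ends of the arrow contain all three vertices of the triangle, so the existential
  in \<open>cyc_deriv\<close> selects a single path.\<close>

lemma cyclic_triangle_from_arrow: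
  assumes "ltriangle p q r"
  shows "(\<exists>c. cyclic_triangle n \<sigma> c \<and> snd c \<noteq> [] \<and> hd (snd c) = (edge_of (q, r), edge_of (p, q)) \<and> P = (edge_of (p, q), tl (snd c)))
    \<longleftrightarrow> P = (edge_of (p, q), [(edge_of (p, q), edge_of (p, r)), (edge_of (p, r), edge_of (q, r))])"
proof
  assume "P = (edge_of (p, q), [(edge_of (p, q), edge_of (p, r)), (edge_of (p, r), edge_of (q, r))])"
  moreover have "ltriangle q r (p + N)" using assms ltriangle_rot by blast
  then have "cyclic_triangle n \<sigma> (edge_of (q, r), tricycle q r (p + N))"
    using cyclic_triangle_iff by blast
  moreover have "tricycle q r (p + N) = [(edge_of (q, r), edge_of (p, q)), (edge_of (p, q), edge_of (p, r)), (edge_of (p, r), edge_of (q, r))]"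
    by (auto simp: tricycle_def edge_of_pair)
  ultimately show "\<exists>c. cyclic_triangle n \<sigma> c \<and> snd c \<noteq> [] \<and> hd (snd c) = (edge_of (q, r), edge_of (p, q)) \<and> P = (edge_of (p, q), tl (snd c))"
    by (intro exI[of _ "(edge_of (q, r), tricycle q r (p + N))"]) simp
next
  assume "\<exists>c. cyclic_triangle n \<sigma> c \<and> snd c \<noteq> [] \<and> hd (snd c) = (edge_of (q, r), edge_of (p, q)) \<and> P = (edge_of (p, q), tl (snd c))"
  then obtain u v w where ltriangle: "ltriangle u v w" and h: "(edge_of (u, v), edge_of (u, w)) = (edge_of (q, r), edge_of (p, q))"
    and P: "P = (edge_of (p, q), [(edge_of (u, w), edge_of (v, w)), (edge_of (v, w), edge_of (u, v))])"
    by (auto simp: cyclic_triangle_iff tricycle_def)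
  have "vertex u = vertex q" "vertex v = vertex r" "vertex w = vertex p"
    using h ltriangle_vertex_neq[OF ltriangle] ltriangle_vertex_neq[OF assms] by (auto simp: edge_of_pair doubleton_eq_iff)
  then show "P = (edge_of (p, q), [(edge_of (p, q), edge_of (p, r)), (edge_of (p, r), edge_of (q, r))])"
    using P by (auto simp: edge_of_pair)
qed

text \<open>\<open>big_cycle\<close> admits any closed path around a vertex with one external arrow,
  so uniqueness must be derived. The two ends of the arrow share only \<open>q\<close>, which is
  therefore the centre. Lifted from \<open>(p, q)\<close>, the remainder ends at some
  \<open>(q, m)\<close>; its end edge forces \<open>m = r\<close>, and turns about \<open>q\<close>
  are determined by their ends.\<close>

lemma big_cycle_from_arrow:
  assumes ltriangle: "ltriangle p q r" and b: "lpath (p, q) b (q, r)" "around q b" "ext_count b = 1"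
  shows "(\<exists>c. big_cycle n \<sigma> c \<and> snd c \<noteq> [] \<and> hd (snd c) = (edge_of (q, r), edge_of (p, q)) \<and> P = (edge_of (p, q), tl (snd c)))
    \<longleftrightarrow> P = (edge_of (p, q), b)"
proof -
  define a where "a = (edge_of (q, r), edge_of (p, q))"
  have e: "edge_of (q, p + N) = edge_of (p, q)" by (auto simp: edge_of_pair)
  have T2: "ltriangle q r (p + N)" using ltriangle ltriangle_rot by blast
  have a_not_ext: "\<not> external_arrow n \<sigma> a"
    using internal_not_external[OF T2] by (simp add: a_def e)
  have chord: "chord p q" "chord q r" using ltriangle by (auto simp: ltriangle_def)
  show ?thesis
  proof
    assume P: "P = (edge_of (p, q), b)"
    have "lpath (q, p + N) b (r, q + N)" using lpath_\<tau>[OF b(1)] by simp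
    then have "lpath (q, r) (a # b) (r, q + N)"
      using lpath_ConsI[OF step.first[OF T2]] by (simp add: a_def e del: lpath.simps)
    then have "path_from_to n \<sigma> (edge_of (q, r)) (edge_of (r, q + N)) (edge_of (q, r), a # b)"
      using lpath_path_from_to chord by simp
    moreover have "edge_of (r, q + N) = edge_of (q, r)" by (auto simp: edge_of_pair)
    moreover have "\<forall>x\<in>set (a # b). vertex q \<in> fst x \<and> vertex q \<in> snd x"
      using b by (auto simp: a_def around_def edge_of_pair)
    ultimately have "big_cycle n \<sigma> (edge_of (q, r), a # b)"
      unfolding big_cycle_def using b(3) a_not_ext
      by (auto simp: ext_count_def path_from_to_def intro!: exI[of _ "vertex q"])
    then show "\<exists>c. big_cycle n \<sigma> c \<and> snd c \<noteq> [] \<and> hd (snd c) = (edge_of (q, r), edge_of (p, q)) \<and> P = (edge_of (p, q), tl (snd c))"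
      using P by (intro exI[of _ "(edge_of (q, r), a # b)"]) (simp add: a_def)
  next
    assume "\<exists>c. big_cycle n \<sigma> c \<and> snd c \<noteq> [] \<and> hd (snd c) = (edge_of (q, r), edge_of (p, q)) \<and> P = (edge_of (p, q), tl (snd c))"
    then obtain c where c: "big_cycle n \<sigma> c" "snd c \<noteq> []" "hd (snd c) = a" "P = (edge_of (p, q), tl (snd c))"
      unfolding a_def by blast
    define b' where "b' = tl (snd c)"
    have sc: "snd c = a # b'" using c by (cases "snd c") (auto simp: b'_def)
    obtain v where v: "\<And>x. x \<in> set (snd c) \<Longrightarrow> v \<in> fst x \<and> v \<in> snd x"
      using c(1) unfolding big_cycle_def by blast
    have "v \<in> edge_of (q, r)" "v \<in> edge_of (p, q)" using v[of a] sc by (auto simp: a_def)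
    then have "v = vertex q" using ltriangle_vertex_neq[OF ltriangle] by (auto simp: edge_of_pair)
    then have ar: "around q b'" using v sc by (auto simp: around_def)
    have ex: "ext_count b' = 1" using c(1) sc a_not_ext by (simp add: big_cycle_def ext_count_def)
    have val: "valid_path n \<sigma> (edge_of (p, q), b')" "pend (edge_of (p, q), b') = edge_of (q, r)"
    proof -
      have cc: "c = (fst c, [a] @ b')" using sc by (simp add: prod_eq_iff)
      have "valid_path n \<sigma> (fst c, [a] @ b')" "pend (fst c, [a] @ b') = fst c"
        using c(1) cc by (auto simp: big_cycle_def pstart_def)
      then show "valid_path n \<sigma> (edge_of (p, q), b')" "pend (edge_of (p, q), b') = edge_of (q, r)"
        unfolding valid_path_append pend_append by (auto simp: pend_def valid_path_def a_def)
    qed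
    obtain y where y: "lpath (p, q) b' y" "edge_of y = edge_of (q, r)" "lifted y"
      using lpath_exists[OF val(1), of "(p, q)"] val(2) chord by auto
    obtain m where m: "y = (q, m)" using lpath_around_one_ext[OF y(1) ar ex] by blast
    have "vertex m = vertex r" using y(2) m ltriangle_vertex_neq[OF ltriangle] by (auto simp: edge_of_pair doubleton_eq_iff)
    then have "m = r" using y(3) m chord chord_less[of q m] chord_less[of q r] by (intro vertex_inj) auto
    then have "b' = b" using lpath_around_unique y(1) m b ar by blast
    then show "P = (edge_of (p, q), b)" using c b'_def by simp
  qed
qed

lemma cyc_deriv_eq:
  assumes "ltriangle p q r" "lpath (p, q) b (q, r)" "around q b" "ext_count b = 1"
  shows "cyc_deriv n \<sigma> (edge_of (q, r), edge_of (p, q)) =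
    (\<lambda>P. pelem (edge_of (p, q), [(edge_of (p, q), edge_of (p, r)), (edge_of (p, r), edge_of (q, r))]) P - pelem (edge_of (p, q), b) P)"
  unfolding cyc_deriv_def pelem_def snd_conv
    cyclic_triangle_from_arrow[OF assms(1)] big_cycle_from_arrow[OF assms] ..

text \<open>If both edges at \<open>q\<close> were sides, the triangle would be an ear and its third
  side would cross the diagonal at \<open>q\<close>. Thus every \<open>rel\<close> of
  \<open>pcong\<close> comes from a permitted generator of the ideal.\<close>

lemma arrow_not_frozen:
  assumes "ltriangle p q r" "has_diagonal q"
  shows "edge_of (q, r) \<notin> frozen n \<or> edge_of (p, q) \<notin> frozen n"
proof (rule ccontr)
  assume *: "\<not> ?thesis"
  have o: "p < q" "q < r" "r < p + N" using ltriangle_less[OF assms(1)] by auto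
  have "r = q + 1" "q = p + 1"
    using * o poly_side_vertex[of q r] poly_side_vertex[of p q] by (auto simp: frozen_def edge_of_pair)
  moreover obtain w where "chord q w" "q + 1 < w" "w < q + N - 1" using assms(2) has_diagonal_iff by blast
  ultimately show False using chord_noncrossing[of p r q w] assms(1) by (auto simp: ltriangle_def)
qed

lemma jac_eq_rel:
  assumes ltriangle: "ltriangle p q r" and has_diagonal: "has_diagonal q" and b: "lpath (p, q) b (q, r)" "around q b" "ext_count b = 1"
    and u: "valid_path n \<sigma> u" "pend u = edge_of (p, q)" and v: "valid_path n \<sigma> v" "pstart v = edge_of (q, r)"
  shows "jac_eq n \<sigma>
    (pelem (fst u, snd u @ [(edge_of (p, q), edge_of (p, r)), (edge_of (p, r), edge_of (q, r))] @ snd v) :: qpath \<Rightarrow> 'k::field)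
    (pelem (fst u, snd u @ b @ snd v))"
proof -
  let ?t = "[(edge_of (p, q), edge_of (p, r)), (edge_of (p, r), edge_of (q, r))]"
  have Vpq: "lifted (p, q)" using ltriangle by (simp add: ltriangle_def)
  have t: "lpath (p, q) ?t (q, r)"
    using lpath_ConsI[OF step.first[OF ltriangle] lpath_ConsI[OF step.second[OF ltriangle]], of "[]"] by simp
  have e: "edge_of (q, p + N) = edge_of (p, q)" by (auto simp: edge_of_pair)
  have "ltriangle q r (p + N)" using ltriangle ltriangle_rot by blast
  then have "(edge_of (q, r), edge_of (p, q)) \<in> qarrows n \<sigma>" using step_arrow[OF step.first] e by metis
  then have "sandwich n \<sigma> u (cyc_deriv n \<sigma> (edge_of (q, r), edge_of (p, q))) v \<in> (jac_ideal n \<sigma> :: (qpath \<Rightarrow> 'k) set)"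
    using jac_ideal.gen u(1) v(1) arrow_not_frozen[OF ltriangle has_diagonal] by (metis fst_conv snd_conv)
  moreover have "sandwich n \<sigma> u (pelem (edge_of (p, q), l)) v = (pelem (fst u, snd u @ l @ snd v) :: qpath \<Rightarrow> 'k)"
    if "lpath (p, q) l (q, r)" for l
    using sandwich_pelem[of n \<sigma> u l v] u(2) v(2) lpath_path_from_to[OF Vpq that]
    by (simp add: path_from_to_def)
  ultimately show ?thesis
    using t b(1) unfolding cyc_deriv_eq[OF ltriangle b] sandwich_diff jac_eq_def by simp
qed

text \<open>Validity is carried as an equivalence because \<open>sym\<close> and
  \<open>trans\<close> need it for the other list or an intermediate one. The surrounding lists
  \<open>us\<close> and \<open>vs\<close> are kept general so that \<open>ctxt\<close> only enlarges
  them.\<close>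

lemma pcong_jac_eq:
  assumes "pcong as bs"
  shows "(valid_path n \<sigma> (s, us @ as @ vs) \<longleftrightarrow> valid_path n \<sigma> (s, us @ bs @ vs)) \<and>
    (valid_path n \<sigma> (s, us @ as @ vs) \<longrightarrow>
      jac_eq n \<sigma> (pelem (s, us @ as @ vs) :: qpath \<Rightarrow> 'k::field) (pelem (s, us @ bs @ vs)))"
  using assms
proof (induction arbitrary: us vs)
  case (rel p q r b)
  let ?t = "[(edge_of (p, q), edge_of (p, r)), (edge_of (p, r), edge_of (q, r))]"
  have Vpq: "lifted (p, q)" using rel by (simp add: ltriangle_def)
  have t: "lpath (p, q) ?t (q, r)"
    using lpath_ConsI[OF step.first[OF rel(1)] lpath_ConsI[OF step.second[OF rel(1)]], of "[]"] by simp
  have "b \<noteq> []" using rel by auto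
  have val: "valid_path n \<sigma> (s, us @ l @ vs) \<longleftrightarrow> valid_path n \<sigma> (s, us) \<and> pend (s, us) = edge_of (p, q) \<and>
    valid_path n \<sigma> (edge_of (q, r), vs)" if "lpath (p, q) l (q, r)" "l \<noteq> []" for l
    using pend_lpath[OF Vpq that(1)] valid_path_lpath_iff[OF Vpq that] by (auto simp: valid_path_append)
  show ?case
  proof (intro conjI impI)
    show "valid_path n \<sigma> (s, us @ ?t @ vs) \<longleftrightarrow> valid_path n \<sigma> (s, us @ b @ vs)"
      using val[OF t] val[OF rel(3) \<open>b \<noteq> []\<close>] by blast
    assume "valid_path n \<sigma> (s, us @ ?t @ vs)"
    then have "valid_path n \<sigma> (s, us)" "pend (s, us) = edge_of (p, q)" "valid_path n \<sigma> (edge_of (q, r), vs)"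
      using val[OF t] by blast+
    then show "jac_eq n \<sigma> (pelem (s, us @ ?t @ vs) :: qpath \<Rightarrow> 'k) (pelem (s, us @ b @ vs))"
      using jac_eq_rel[OF rel, of "(s, us)" "(edge_of (q, r), vs)"] by (simp add: pstart_def)
  qed
next
  case (refl as)
  then show ?case using jac_eq_refl by blast
next
  case (sym as bs)
  then show ?case using jac_eq_sym by blast
next
  case (trans as bs cs)
  then show ?case using jac_eq_trans by blast
next
  case (ctxt as bs us' vs')
  show ?case using ctxt.IH[of "us @ us'" "vs' @ vs"] by simp
qed

lemma lpath_jac_eq:
  assumes "lifted x" "lpath x as y" "lpath x bs y"
  shows "jac_eq n \<sigma> (pelem (edge_of x, as) :: qpath \<Rightarrow> 'k::field) (pelem (edge_of x, bs))"
proof -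
  have "lifted y" using assms lpath_lifted by blast
  then have "pcong as bs" using lpath_unique assms by blast
  moreover have "valid_path n \<sigma> (edge_of x, as)"
    using lpath_path_from_to assms by (auto simp: path_from_to_def)
  ultimately show ?thesis using pcong_jac_eq[where 'k = 'k, of as bs "edge_of x" "[]" "[]"] by simp
qed

section \<open>Lengths and lifts of minimal cycles\<close>

text \<open>In units of pi/n the angles of a triangle add up to \<open>n\<close>; around a polygon
  vertex the interior angle contributes \<open>n - 2\<close> and the external arrow 2. In the cover
  both are the height difference of one application of \<open>\<tau>\<close>.\<close>

lemma minimal_cycle_theta:
  assumes c: "minimal_cycle_at n \<sigma> j c"
  shows "theta_len n \<sigma> c = n" "path_from_to n \<sigma> j j c"
proof -
  have j: "pstart c = j" "valid_path n \<sigma> c" "pend c = j"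
    using c by (auto simp: minimal_cycle_at_def cyclic_triangle_def big_cycle_def)
  then show "path_from_to n \<sigma> j j c" by (simp add: path_from_to_def)
  consider "cyclic_triangle n \<sigma> c" | "big_cycle n \<sigma> c" using c by (auto simp: minimal_cycle_at_def)
  then show "theta_len n \<sigma> c = n"
  proof cases
    case 1
    then obtain p q r where ltriangle: "ltriangle p q r" "c = (edge_of (p, q), tricycle p q r)"
      using cyclic_triangle_iff by blast
    then have "int (theta_len n \<sigma> c) = N" using lpath_theta[OF lpath_tricycle[OF ltriangle(1)]] by simp
    then show ?thesis by simp
  next
    case 2
    then obtain v where v: "v < n" "\<And>x. x \<in> set (snd c) \<Longrightarrow> v \<in> fst x \<and> v \<in> snd x"
      unfolding big_cycle_def by blast
    have ex: "ext_count (snd c) = 1" using 2 by (simp add: big_cycle_def ext_count_def)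
    define q where "q = int v"
    have q: "vertex q = v" using v vertex_of_nat by (simp add: q_def)
    have ar: "around q (snd c)" using v q by (auto simp: around_def)
    have ne: "snd c \<noteq> []" using ex by auto
    then have "fst (hd (snd c)) = j" using j by (cases "snd c") (auto simp: valid_path_def pstart_def)
    then have "v \<in> j" using v(2)[of "hd (snd c)"] ne by auto
    moreover have "j \<in> qverts n \<sigma>" using j by (auto simp: valid_path_def pstart_def)
    ultimately obtain m where m: "chord q m" "j = {vertex q, vertex m}" using edge_lift q by metis
    \<comment> \<open>The centre \<open>q\<close> is put in second place, as
      \<open>lpath_around_one_ext\<close> requires; the cycle then ends at \<open>(q, m)\<close>,
      which is higher by \<open>N\<close>.\<close>
    have chord: "chord (m - N) q" using m chord_tau' by blast
    have jm: "edge_of (m - N, q) = j" using m by (simp add: edge_of_pair insert_commute)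
    obtain y where y: "lpath (m - N, q) (snd c) y" "edge_of y = j" "lifted y"
      using path_lift[of c "(m - N, q)"] j chord jm by (auto simp only: pstart_def lifted_pair)
    obtain m' where m': "y = (q, m')" using lpath_around_one_ext[OF y(1) ar ex] by blast
    have l: "q < m" "m < q + N" "q < m'" "m' < q + N" using m y m' chord_less by auto
    have "vertex m' = vertex m" using y(2) m m' by (auto simp: edge_of_pair doubleton_eq_iff)
    then have "m' = m" using l by (intro vertex_inj) auto
    then have "int (theta_len n \<sigma> (fst c, snd c)) = N" using lpath_theta[OF y(1), of "fst c"] m' by simp
    then show ?thesis unfolding prod.collapse by simp
  qed
qed

text \<open>The end is a lift of the same edge, higher by \<open>N\<close>, and the height
  identifies the lift. So all minimal cycles at an edge have the same lifted ends.\<close>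

lemma lpath_minimal_cycle:
  assumes c: "minimal_cycle_at n \<sigma> (edge_of y) c" and y: "lifted y"
  shows "lpath y (snd c) (\<tau> y)"
proof -
  have p: "path_from_to n \<sigma> (edge_of y) (edge_of y) c" using minimal_cycle_theta(2)[OF c] .
  then obtain z where z: "lpath y (snd c) z" "edge_of z = edge_of y" "lifted z"
    using path_lift[of c y] y by (auto simp only: path_from_to_def pstart_def)
  have "height z - height y = N"
    using lpath_theta[OF z(1), of "fst c"] minimal_cycle_theta(1)[OF c] by simp
  then have "z = \<tau> y" using z y by (intro edge_of_height_inj) (auto simp: height_\<tau>)
  then show ?thesis using z by simp
qed

lemma lpath_cyc_pow:
  assumes "minimal_cycle_at n \<sigma> (edge_of y) c" "lifted y"
  shows "lpath y (snd (cyc_pow c k)) ((\<tau> ^^ k) y)"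
proof -
  have "lpath ((\<tau> ^^ m) y) (concat (replicate k (snd c))) ((\<tau> ^^ (m + k)) y)" for m
  proof (induction k arbitrary: m)
    case (Suc k)
    have m: "edge_of ((\<tau> ^^ m) y) = edge_of y \<and> lifted ((\<tau> ^^ m) y)" by (induction m) (auto simp: assms)
    then have "lpath ((\<tau> ^^ m) y) (snd c) ((\<tau> ^^ Suc m) y)"
      using lpath_minimal_cycle[of "(\<tau> ^^ m) y" c] assms by simp
    moreover have "lpath ((\<tau> ^^ Suc m) y) (concat (replicate k (snd c))) ((\<tau> ^^ (m + Suc k)) y)"
      using Suc.IH[of "Suc m"] by simp
    ultimately show ?case unfolding replicate_Suc concat.simps lpath_append by blast
  qed simp
  from this[of 0] show ?thesis by (simp add: cyc_pow_def)
qed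

lemma pow_\<tau>: "edge_of ((\<tau> ^^ k) y) = edge_of y" "lifted ((\<tau> ^^ k) y) = lifted y" "height ((\<tau> ^^ k) y) = height y + int k * N"
  by (induction k) (auto simp: height_\<tau> algebra_simps)

section \<open>Paths of minimal length\<close>

text \<open>Any path of least length serves as \<open>w0\<close>, so one is chosen by
  \<open>arg_min\<close> instead of being constructed.\<close>

definition min_path :: "edge \<Rightarrow> edge \<Rightarrow> qpath" where
  "min_path i j = arg_min (theta_len n \<sigma>) (path_from_to n \<sigma> i j)"

lemma path_exists:
  assumes "i \<in> qverts n \<sigma>" "j \<in> qverts n \<sigma>"
  shows "\<exists>w. path_from_to n \<sigma> i j w"
proof -
  obtain p q where x: "chord p q" "edge_of (p, q) = i" using edge_of_lift[OF assms(1)] by (metis lifted_pair surj_pair)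
  obtain c d where y: "chord c d" "edge_of (c, d) = j" using edge_of_lift[OF assms(2)] by (metis lifted_pair surj_pair)
  \<comment> \<open>Large enough that the translate of \<open>(c, d)\<close> by \<open>k * N\<close>
    lies above \<open>(p, q)\<close>.\<close>
  define k where "k = \<bar>p\<bar> + \<bar>q\<bar> + \<bar>c\<bar> + \<bar>d\<bar>"
  have "k \<le> k * N" using mult_left_mono[of 1 N k] N3 by (simp add: k_def)
  moreover have "p \<le> c + k" "q \<le> d + k" by (auto simp: k_def)
  ultimately have "dominates (p, q) (c + k * N, d + k * N)" by simp
  moreover have "lifted (c + k * N, d + k * N)" using y chord_shift by simp
  ultimately obtain as where "lpath (p, q) as (c + k * N, d + k * N)"
    using lpath_connected[of "(p, q)" "(c + k * N, d + k * N)"] x lifted_pair by blast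
  then have "path_from_to n \<sigma> i (edge_of (c + k * N, d + k * N)) (i, as)"
    using lpath_path_from_to[of "(p, q)"] x by simp
  moreover have "edge_of (c + k * N, d + k * N) = j" using y by (simp add: edge_of_pair)
  ultimately show ?thesis by auto
qed

lemma min_path_path:
  assumes "i \<in> qverts n \<sigma>" "j \<in> qverts n \<sigma>"
  shows "path_from_to n \<sigma> i j (min_path i j)"
  using path_exists[OF assms] arg_min_natI unfolding min_path_def by fast

lemma min_path_le: "path_from_to n \<sigma> i j w \<Longrightarrow> theta_len n \<sigma> (min_path i j) \<le> theta_len n \<sigma> w"
  unfolding min_path_def by (rule arg_min_nat_le)

lemma min_path_lift:
  assumes "lifted x" "j \<in> qverts n \<sigma>"
  obtains y where "lpath x (snd (min_path (edge_of x) j)) y" "edge_of y = j" "lifted y"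
    "int (theta_len n \<sigma> (min_path (edge_of x) j)) = height y - height x"
proof -
  let ?w = "min_path (edge_of x) j"
  have w: "path_from_to n \<sigma> (edge_of x) j ?w" using min_path_path edge_of_qverts assms by blast
  then obtain y where y: "lpath x (snd ?w) y" "edge_of y = j" "lifted y"
    using path_lift[of ?w x] assms(1) by (auto simp only: path_from_to_def pstart_def)
  moreover have "int (theta_len n \<sigma> ?w) = height y - height x"
    using lpath_theta[OF y(1), of "fst ?w"] by simp
  ultimately show ?thesis using that by blast
qed

text \<open>Lifted from the same \<open>x\<close>, both paths end at lifts of \<open>j\<close>.
  Minimality makes the height difference a nonnegative multiple \<open>k * N\<close>, so
  \<open>z\<close> is the \<open>k\<close>-th \<open>\<tau>\<close>-translate of \<open>y\<close>,
  and \<open>k\<close> minimal cycles lead from \<open>y\<close> to \<open>z\<close>. The exponent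
  is read off from heights, hence is the same for every cycle \<open>c\<close>.\<close>

lemma path_eq_min_path_cyc_pow:
  assumes i: "i \<in> qverts n \<sigma>" and w: "path_from_to n \<sigma> i j w"
  shows "\<exists>k. \<forall>c. minimal_cycle_at n \<sigma> j c \<longrightarrow>
    jac_eq n \<sigma> (pelem w :: qpath \<Rightarrow> 'k::field) (pelem (pcat (min_path i j) (cyc_pow c k)))"
proof -
  obtain x where x: "lifted x" "edge_of x = i" using edge_of_lift i by blast
  have w': "fst w = i" "pend w = j" "valid_path n \<sigma> w" using w by (auto simp: path_from_to_def pstart_def)
  then have j: "j \<in> qverts n \<sigma>" using pend_qverts by blast
  obtain z where z: "lpath x (snd w) z" "edge_of z = j" "lifted z"
    using path_lift[OF w'(3) x(1)] w' x by metis
  obtain y where y: "lpath x (snd (min_path i j)) y" "edge_of y = j" "lifted y"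
    "int (theta_len n \<sigma> (min_path i j)) = height y - height x" using min_path_lift[OF x(1) j] x(2) by metis
  have "int (theta_len n \<sigma> w) = height z - height x" using lpath_theta[OF z(1), of "fst w"] by simp
  then have heights: "height y \<le> height z" using y(4) min_path_le[OF w] by linarith
  obtain m where m: "height z = height y + m * N" using edge_of_height_cong[of y z] y z by auto
  have "0 \<le> m" using heights m N3 by (simp add: zero_le_mult_iff)
  then obtain k where k: "m = int k" using nonneg_int_cases by blast
  have z': "z = (\<tau> ^^ k) y" using y z m k pow_\<tau> by (intro edge_of_height_inj) auto
  have start: "fst (min_path i j) = i" using min_path_path[OF i j] by (simp add: path_from_to_def pstart_def)
  show ?thesis
  proof (intro exI[of _ k] allI impI)
    fix c assume "minimal_cycle_at n \<sigma> j c"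
    then have "lpath y (snd (cyc_pow c k)) z" using lpath_cyc_pow y z' by metis
    then have "lpath x (snd (min_path i j) @ snd (cyc_pow c k)) z" using y lpath_append by blast
    then show "jac_eq n \<sigma> (pelem w :: qpath \<Rightarrow> 'k) (pelem (pcat (min_path i j) (cyc_pow c k)))"
      using lpath_jac_eq[OF x(1) z(1)] x(2) w'(1) start by (metis pcat_def prod.collapse)
  qed
qed

section \<open>The maximum formula\<close>

text \<open>The right side says that \<open>y\<close> is the lowest lift of its edge above
  \<open>x\<close>. If \<open>\<tau> x\<close> were below \<open>y\<close>, a path from it would be
  shorter by \<open>N\<close>; if a lower lift \<open>z\<close> were reached from \<open>x\<close>,
  then \<open>y\<close> would lie above \<open>\<tau> z\<close> and so above
  \<open>\<tau> x\<close>.\<close>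

lemma theta_min_path_iff:
  assumes x: "lifted x" and y: "lifted y" and dominates: "dominates x y"
  shows "int (theta_len n \<sigma> (min_path (edge_of x) (edge_of y))) = height y - height x \<longleftrightarrow> \<not> dominates (\<tau> x) y"
proof
  assume *: "int (theta_len n \<sigma> (min_path (edge_of x) (edge_of y))) = height y - height x"
  show "\<not> dominates (\<tau> x) y"
  proof
    assume "dominates (\<tau> x) y"
    then obtain as where as: "lpath (\<tau> x) as y" using lpath_connected x y by (meson lifted_\<tau>)
    have "path_from_to n \<sigma> (edge_of x) (edge_of y) (edge_of x, as)"
      using lpath_path_from_to[OF _ as] x by simp
    then have "theta_len n \<sigma> (min_path (edge_of x) (edge_of y)) \<le> theta_len n \<sigma> (edge_of x, as)" by (rule min_path_le)
    then show False using * lpath_theta[OF as, of "edge_of x"] height_\<tau> N3 by simp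
  qed
next
  assume n: "\<not> dominates (\<tau> x) y"
  obtain z where z: "lpath x (snd (min_path (edge_of x) (edge_of y))) z" "edge_of z = edge_of y" "lifted z"
    "int (theta_len n \<sigma> (min_path (edge_of x) (edge_of y))) = height z - height x"
    using min_path_lift[OF x] edge_of_qverts[OF y] by metis
  obtain as where as: "lpath x as y" using lpath_connected x y dominates by blast
  have "theta_len n \<sigma> (min_path (edge_of x) (edge_of y)) \<le> theta_len n \<sigma> (edge_of x, as)"
    using min_path_le lpath_path_from_to[OF x as] by blast
  then have hle: "height z \<le> height y" using z(4) lpath_theta[OF as, of "edge_of x"] by linarith
  have xz: "fst x \<le> fst z" "snd x \<le> snd z" using lpath_mono[OF z(1)] by auto
  have xl: "snd x < fst x + N" "fst x < snd x" using x chord_less by (auto simp: lifted_def)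
  have "\<not> height z < height y"
  proof
    assume lt: "height z < height y"
    from z(3) y z(2) show False
    proof (cases rule: edge_of_eq_cases)
      case (1 k)
      have "0 < 2 * k * N" using lt 1 by (simp add: height_def)
      then have "1 \<le> k" using N3 by (simp add: zero_less_mult_iff)
      then have "N \<le> k * N" using N3 by simp
      moreover have "fst y = fst z + k * N" "snd y = snd z + k * N" using 1 by simp_all
      ultimately have "snd x \<le> fst y" "fst x + N \<le> snd y" using xz xl by linarith+
      then show False using n by (simp add: dominates_def \<tau>_def)
    next
      case (2 k)
      have "0 < (2 * k + 1) * N" using lt 2 by (simp add: height_def algebra_simps)
      then have "0 \<le> k" using N3 by (simp add: zero_less_mult_iff)
      then have "0 \<le> k * N" by simp
      then have "snd x \<le> fst y" "fst x + N \<le> snd y" using 2 xz xl by simp_all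
      then show False using n by (simp add: dominates_def \<tau>_def)
    qed
  qed
  then show "int (theta_len n \<sigma> (min_path (edge_of x) (edge_of y))) = height y - height x" using hle z(4) by simp
qed

lemma theta_min_path_triangle:
  assumes "k \<in> qverts n \<sigma>" "i \<in> qverts n \<sigma>" "j \<in> qverts n \<sigma>"
  shows "theta_len n \<sigma> (min_path k j) \<le> theta_len n \<sigma> (min_path k i) + theta_len n \<sigma> (min_path i j)"
proof -
  obtain as where as: "min_path k i = (k, as)" using min_path_path[OF assms(1,2)]
    by (cases "min_path k i") (auto simp: path_from_to_def pstart_def)
  obtain bs where bs: "min_path i j = (i, bs)" using min_path_path[OF assms(2,3)]
    by (cases "min_path i j") (auto simp: path_from_to_def pstart_def)
  have "path_from_to n \<sigma> k j (k, as @ bs)"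
    using min_path_path[OF assms(1,2)] min_path_path[OF assms(2,3)] as bs
    by (auto simp: path_from_to_def pstart_def valid_path_append pend_append)
  then have "theta_len n \<sigma> (min_path k j) \<le> theta_len n \<sigma> (k, as @ bs)" by (rule min_path_le)
  then show ?thesis using theta_len_append as bs by metis
qed

text \<open>If a lift \<open>s\<close> of a side has both \<open>x\<close> and \<open>y\<close> as
  lowest lifts above it, the two lengths from \<open>s\<close> are height differences and subtract
  to that from \<open>x\<close> to \<open>y\<close>. Minimality from \<open>x\<close> to
  \<open>y\<close> gives \<open>d < p + N\<close> or \<open>c < q\<close>. In these cases
  \<open>\<tau> s\<close> is \<open>(p + 1, p + N)\<close> or \<open>(q, q + 1)\<close>, which is
  below neither \<open>x\<close> nor \<open>y\<close>.\<close>

lemma theta_min_path_attained: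
  assumes "i \<in> qverts n \<sigma>" "j \<in> qverts n \<sigma>"
  shows "\<exists>k\<in>frozen n. int (theta_len n \<sigma> (min_path i j)) =
    int (theta_len n \<sigma> (min_path k j)) - int (theta_len n \<sigma> (min_path k i))"
proof -
  obtain x where x: "lifted x" "edge_of x = i" using edge_of_lift assms by blast
  obtain y where y: "lpath x (snd (min_path i j)) y" "edge_of y = j" "lifted y"
    "int (theta_len n \<sigma> (min_path i j)) = height y - height x" using min_path_lift[OF x(1) assms(2)] x(2) by metis
  obtain p q c d where xy: "x = (p, q)" "y = (c, d)" by (cases x, cases y)
  have dominates: "dominates x y" using lpath_mono[OF y(1)] by (simp add: dominates_def)
  have "\<not> dominates (\<tau> x) y" using theta_min_path_iff[OF x(1) y(3) dominates] x y by simp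
  then have cd: "c < q \<or> d < p + N" by (auto simp: xy)
  have o: "p < q" "q < p + N" "p \<le> c" "q \<le> d" using x(1) dominates chord_less by (auto simp: xy)
  \<comment> \<open>The side leaving \<open>p\<close> or the side leaving \<open>q\<close>, lifted just below \<open>x\<close>, is minimal for both \<open>x\<close> and \<open>y\<close>.\<close>
  have "\<exists>s. lifted s \<and> edge_of s \<in> frozen n \<and> dominates s x \<and> dominates s y \<and> \<not> dominates (\<tau> s) x \<and> \<not> dominates (\<tau> s) y"
  proof (cases "d < p + N")
    case True
    then show ?thesis using o chord_side
      by (intro exI[of _ "(p, p + 1)"]) (auto simp: xy frozen_def poly_side_iff edge_of_pair)
  next
    case False
    then have "c < q" using cd by simp
    moreover have "chord (q + 1 - N) q" using chord_side chord_tau' by blast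
    moreover have "edge_of (q + 1 - N, q) \<in> frozen n"
      unfolding edge_of_reduce by (auto simp: frozen_def poly_side_iff edge_of_pair)
    ultimately show ?thesis using o
      by (intro exI[of _ "(q + 1 - N, q)"]) (auto simp: xy)
  qed
  then obtain s where s: "lifted s" "edge_of s \<in> frozen n" "dominates s x" "dominates s y" "\<not> dominates (\<tau> s) x" "\<not> dominates (\<tau> s) y"
    by blast
  then show ?thesis
    using theta_min_path_iff[OF s(1) x(1) s(3)] theta_min_path_iff[OF s(1) y(3) s(4)] x y
    by (intro bexI[of _ "edge_of s"]) auto
qed

lemma theta_min_path_Max:
  assumes "i \<in> qverts n \<sigma>" "j \<in> qverts n \<sigma>"
  shows "int (theta_len n \<sigma> (min_path i j)) =
    Max ((\<lambda>k. int (theta_len n \<sigma> (min_path k j)) - int (theta_len n \<sigma> (min_path k i))) ` frozen n)"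
proof (rule Max_eqI[symmetric])
  have "frozen n = (\<lambda>a. {a, (a + 1) mod n}) ` {..<n}" by (auto simp: frozen_def poly_side_def)
  then show "finite ((\<lambda>k. int (theta_len n \<sigma> (min_path k j)) - int (theta_len n \<sigma> (min_path k i))) ` frozen n)"
    by simp
  show "int (theta_len n \<sigma> (min_path i j)) \<in>
      (\<lambda>k. int (theta_len n \<sigma> (min_path k j)) - int (theta_len n \<sigma> (min_path k i))) ` frozen n"
    using theta_min_path_attained[OF assms] by blast
next
  fix l assume "l \<in> (\<lambda>k. int (theta_len n \<sigma> (min_path k j)) - int (theta_len n \<sigma> (min_path k i))) ` frozen n"
  then obtain k where k: "k \<in> frozen n" "l = int (theta_len n \<sigma> (min_path k j)) - int (theta_len n \<sigma> (min_path k i))"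
    by blast
  have "k \<in> qverts n \<sigma>" using k by (simp add: frozen_def qverts_def)
  then show "l \<le> int (theta_len n \<sigma> (min_path i j))" using theta_min_path_triangle[of k i j] assms k(2) by linarith
qed

end

theorem theorem2p17:
  fixes n :: nat and \<sigma> :: "nat set set"
  assumes "n \<ge> 3" and "triangulation n \<sigma>"
  shows "\<exists>w0 :: edge \<Rightarrow> edge \<Rightarrow> qpath.
    (\<forall>i\<in>qverts n \<sigma>. \<forall>j\<in>qverts n \<sigma>.
       path_from_to n \<sigma> i j (w0 i j) \<and>
       (\<forall>w. path_from_to n \<sigma> i j w \<longrightarrow> theta_len n \<sigma> (w0 i j) \<le> theta_len n \<sigma> w) \<and>
       (\<forall>w. path_from_to n \<sigma> i j w \<longrightarrow>
          (\<exists>N. \<forall>c. minimal_cycle_at n \<sigma> j c \<longrightarrow>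
             jac_eq n \<sigma> (pelem w :: qpath \<Rightarrow> 'k::field) (pelem (pcat (w0 i j) (cyc_pow c N))))))
    \<and> (\<forall>i\<in>qverts n \<sigma>. \<forall>j\<in>qverts n \<sigma>.
         int (theta_len n \<sigma> (w0 i j)) =
         Max ((\<lambda>k. int (theta_len n \<sigma> (w0 k j)) - int (theta_len n \<sigma> (w0 k i))) ` frozen n))"
proof -
  interpret triangulated_polygon n \<sigma> by unfold_locales (use assms in auto)
  show ?thesis
    using min_path_path min_path_le path_eq_min_path_cyc_pow theta_min_path_Max by (intro exI[of _ min_path]) blast
qed

end
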